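(* Suppose that $\lambda=\lambda^{<\lambda}$ is an uncountable cardinal and $2^\lambda=\lambda^+$. If there exists a $\square(\lambda^+,\lambda)$-sequence $\langle \mathcal C_\alpha\mid\alpha<\lambda^+\rangle$ for which the set $\{ \alpha\in E^{\lambda^+}_{<\lambda}\mid |\mathcal C_\alpha|<\lambda\}$ is stationary in $\lambda^+$, then there exists a $\lambda^+$-Souslin tree.
   Context: For a set of ordinals $C$, $\mathrm{acc}(C):=\{\alpha\in C\mid \sup (C\cap\alpha) = \alpha>0 \}$. For regular uncountable cardinals $\kappa,\lambda$, $E^\kappa_{<\lambda}:=\{\alpha<\kappa\mid \mathrm{cf}(\alpha)<\lambda\}$. For a regular uncountable cardinal $\kappa$ and a cardinal $\mu$, a $\square(\kappa,{<}\mu)$-sequence is a sequence $\langle \mathcal C_\alpha\mid\alpha<\kappa\rangle$ such that: (1) for every limit ordinal $\alpha<\kappa$: $\mathcal C_\alpha$ is a nonempty collection of club (closed and unbounded) subsets of $\alpha$, with $|\mathcal C_\alpha|<\mu$; and for every $C\in\mathcal C_\alpha$ and $\bar\alpha\in\mathrm{acc}(C)$, we have $C\cap\bar\alpha\in\mathcal C_{\bar\alpha}$; (2) for every club $D\subseteq\kappa$, there is $\alpha\in\mathrm{acc}(D)$ such that $D\cap\alpha\notin\mathcal C_\alpha$. There are no restrictions on the order-types of the sets $C\in\mathcal C_\alpha$. The principle $\square(\kappa,{<}\mu)$ asserts that such a sequence exists; $\square(\kappa,\mu)$ stands for $\square(\kappa,{<}\mu^+)$, and a $\square(\kappa,\mu)$-sequence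 is a $\square(\kappa,{<}\mu^+)$-sequence. A $\kappa$-Souslin tree is a (set-theoretic) tree of height $\kappa$ having no chains of size $\kappa$ and no antichains of size $\kappa$. *)

theory Defs
  imports Main
begin

unbundle cardinal_syntax

text \<open>
  Cardinals and ordinals are well-order relations, as in the BNF cardinal library. A cardinal
  \<open>k\<close> (with \<open>Card_order k\<close>) is an initial ordinal, so the ordinals below it are the elements of
  \<open>Field k\<close>, ordered by \<open>k\<close>, and \<open>underS k \<alpha>\<close> is the set of ordinals below \<open>\<alpha>\<close>. The successor
  cardinal of \<open>r\<close> is \<open>cardSuc r\<close>.
\<close>

subsection \<open>Cardinal arithmetic\<close>

text \<open>
  The cardinality of the set of all functions from some ordinal below \<open>r\<close> to \<open>r\<close>. The domain
  is recorded in a pair because an element of \<open>Func\<close>, being a total function equal to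
  \<open>undefined\<close> off its domain, need not determine that domain.
\<close>
definition cexp_less :: "'a rel \<Rightarrow> ('a \<times> ('a \<Rightarrow> 'a)) rel" where
  "cexp_less r = |SIGMA \<alpha> : Field r. Func (underS r \<alpha>) (Field r)|"

text \<open>
  The library's \<open>cofinal\<close> asks for strictly larger elements, so it has no instance below a
  successor ordinal; the condition here is the usual one, giving cofinality 1 to successors and
  0 to zero.
\<close>
definition cofinal_in :: "'a rel \<Rightarrow> 'a \<Rightarrow> 'a set \<Rightarrow> bool" where
  "cofinal_in k \<alpha> A \<longleftrightarrow> A \<subseteq> underS k \<alpha> \<and> (\<forall>\<beta>\<in>underS k \<alpha>. \<exists>\<gamma>\<in>A. (\<beta>, \<gamma>) \<in> k)"

definition cf :: "'a rel \<Rightarrow> 'a \<Rightarrow> 'a rel" where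
  "cf k \<alpha> = |SOME A. cofinal_in k \<alpha> A \<and> (\<forall>B. cofinal_in k \<alpha> B \<longrightarrow> |A| \<le>o |B| )|"

definition E_less :: "'a rel \<Rightarrow> 'b rel \<Rightarrow> 'a set" where
  "E_less k l = {\<alpha> \<in> Field k. cf k \<alpha> <o l}"


subsection \<open>Clubs and stationary sets\<close>

definition sup_below :: "'a rel \<Rightarrow> 'a set \<Rightarrow> 'a \<Rightarrow> 'a" where
  "sup_below k C \<alpha> = wo_rel.supr k (C \<inter> underS k \<alpha>)"

text \<open>\<open>underS k \<alpha> \<noteq> {}\<close> says that \<open>\<alpha> > 0\<close>.\<close>
definition acc_pts :: "'a rel \<Rightarrow> 'a set \<Rightarrow> 'a set" where
  "acc_pts k C = {\<alpha> \<in> C. sup_below k C \<alpha> = \<alpha> \<and> underS k \<alpha> \<noteq> {}}"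

definition limit_ord :: "'a rel \<Rightarrow> 'a \<Rightarrow> bool" where
  "limit_ord k \<alpha> \<longleftrightarrow> \<alpha> \<in> Field k \<and> sup_below k (Field k) \<alpha> = \<alpha> \<and> underS k \<alpha> \<noteq> {}"

text \<open>
  \<open>S\<close> is an ordinal, viewed as the set of its elements: \<open>underS k \<alpha>\<close> for a limit ordinal \<open>\<alpha>\<close>,
  or \<open>Field k\<close>.
\<close>
definition club_in :: "'a rel \<Rightarrow> 'a set \<Rightarrow> 'a set \<Rightarrow> bool" where
  "club_in k S C \<longleftrightarrow> C \<subseteq> S
     \<and> (\<forall>\<beta>\<in>S. \<exists>\<gamma>\<in>C. (\<beta>, \<gamma>) \<in> k)
     \<and> (\<forall>\<beta>\<in>S. sup_below k C \<beta> = \<beta> \<and> underS k \<beta> \<noteq> {} \<longrightarrow> \<beta> \<in> C)"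

definition stationary_in :: "'a rel \<Rightarrow> 'a set \<Rightarrow> bool" where
  "stationary_in k S \<longleftrightarrow> S \<subseteq> Field k \<and> (\<forall>D. club_in k (Field k) D \<longrightarrow> S \<inter> D \<noteq> {})"


subsection \<open>Square sequences\<close>

text \<open>Meant for regular uncountable \<open>k\<close>; successors of infinite cardinals are regular.\<close>
definition square_less_seq :: "'a rel \<Rightarrow> 'b rel \<Rightarrow> ('a \<Rightarrow> 'a set set) \<Rightarrow> bool" where
  "square_less_seq k \<mu> \<C> \<longleftrightarrow>
     (\<forall>\<alpha>. limit_ord k \<alpha> \<longrightarrow>
        \<C> \<alpha> \<noteq> {}
        \<and> (\<forall>C\<in>\<C> \<alpha>. club_in k (underS k \<alpha>) C)
        \<and> |\<C> \<alpha>| <o \<mu>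
        \<and> (\<forall>C\<in>\<C> \<alpha>. \<forall>\<beta>\<in>acc_pts k C. C \<inter> underS k \<beta> \<in> \<C> \<beta>))
     \<and> (\<forall>D. club_in k (Field k) D \<longrightarrow> (\<exists>\<alpha>\<in>acc_pts k D. D \<inter> underS k \<alpha> \<notin> \<C> \<alpha>))"

definition square_seq :: "'a rel \<Rightarrow> 'b rel \<Rightarrow> ('a \<Rightarrow> 'a set set) \<Rightarrow> bool" where
  "square_seq k \<mu> \<C> \<longleftrightarrow> square_less_seq k (cardSuc \<mu>) \<C>"


subsection \<open>Trees\<close>

text \<open>
  A tree is given by its reflexive order \<open>T\<close>; its set of nodes is \<open>Field T\<close>.
\<close>
definition is_tree :: "'a rel \<Rightarrow> bool" where
  "is_tree T \<longleftrightarrow> Partial_order T \<and> (\<forall>x\<in>Field T. Well_order (Restr T (underS T x)))"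

text \<open>The nodes whose set of predecessors has the order type of the well-order \<open>w\<close>.\<close>
definition tree_level :: "'a rel \<Rightarrow> 'b rel \<Rightarrow> 'a set" where
  "tree_level T w = {x \<in> Field T. Restr T (underS T x) =o w}"

text \<open>The height is the least ordinal whose level is empty.\<close>
definition tree_has_height :: "'a rel \<Rightarrow> 'b rel \<Rightarrow> bool" where
  "tree_has_height T k \<longleftrightarrow>
     tree_level T k = {} \<and> (\<forall>\<alpha>\<in>Field k. tree_level T (Restr k (underS k \<alpha>)) \<noteq> {})"

definition antichains :: "'a rel \<Rightarrow> 'a set set" where
  "antichains T = {A. A \<subseteq> Field T \<and> (\<forall>x\<in>A. \<forall>y\<in>A. x \<noteq> y \<longrightarrow> (x, y) \<notin> T \<and> (y, x) \<notin> T)}"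

definition Souslin_tree :: "'b rel \<Rightarrow> 'a rel \<Rightarrow> bool" where
  "Souslin_tree k T \<longleftrightarrow> is_tree T \<and> tree_has_height T k
     \<and> (\<forall>A\<in>Chains T. \<not> |A| =o k)
     \<and> (\<forall>A\<in>antichains T. \<not> |A| =o k)"

end

theory Submission
  imports Defs
begin

text \<open>
  Write \<open>k\<close> for the successor of \<open>l\<close> and \<open>S\<close> for the given stationary set. For \<open>a \<in> S\<close> both the
  cofinality of \<open>a\<close> and \<open>|\<C> a|\<close> are below the regular cardinal \<open>l\<close>, so among \<open>l\<close> many failures at
  \<open>a\<close>, each witnessed by some \<open>C \<in> \<C> a\<close> and some \<open>e < a\<close>, there are \<open>l\<close> many with the same
  witnesses. This is used twice: to guess clubs at the gaps of all members of \<open>\<C> a\<close> in the manner of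
  Shelah, starting from a Kurepa type argument that exploits the nontriviality of the square sequence,
  and then, with \<open>2\<^sup>l = k\<close>, to find a function of the gaps which guesses any assignment of \<open>l\<close>-sized
  sets of nodes to the ordinals below \<open>k\<close>.

  The tree is built by recursion. Its branches at a limit level \<open>a\<close> climb canonically along some
  \<open>C \<in> \<C> a\<close>, meeting a guessed node at every gap of \<open>C\<close> where they can; coherence makes the
  construction go through at accumulation points. Given an antichain, a correct guess at \<open>a \<in> S\<close>
  makes every branch at level \<open>a\<close> pass an element of the antichain unless no extension of it does, so
  the antichain is contained in the levels below \<open>a\<close>.
\<close>

subsection \<open>Clubs in a successor cardinal\<close>

text \<open>A node of level \<open>a\<close> may climb along any \<open>C \<in> \<C> a\<close> and
  may start at any \<open>z \<prec> a\<close>, so one stage \<open>a \<in> S\<close> has to serve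
  all pairs \<open>(C, e)\<close> simultaneously; a guess that is correct along one ladder says
  nothing about the branches on the others. Hence both guessing statements quantify over all
  \<open>C\<close> and \<open>e\<close>, and it is the failures, each needing just one bad pair,
  that are counted. The recursion for the tree uses the guesses, so the guesses must precede the
  tree. They name nodes from the fixed set \<open>all_nodes\<close>, which has size at most
  \<open>|K|\<close> because \<open>2\<^sup>l = k\<close>. Many branches cross the same gap, so the
  guess is not a single node but a set, with one node for each of the at most \<open>l\<close> nodes
  at the bottom of the gap. That levels stay this small relies on the climb being canonical: a
  branch is determined by \<open>C\<close>, the starting point and the starting node. The hypothesis
  \<open>cexp_less l =o l\<close> enters as the regularity of \<open>l\<close>.\<close>

text \<open>
  \<open>K\<close> is the successor cardinal of \<open>l\<close>, as an initial segment of a well-order of the whole type, so that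
  the order needs no carrier; the elements outside \<open>K\<close> play no role.
\<close>
locale succ_card = wellorder less_eq less
  for less_eq :: "'b \<Rightarrow> 'b \<Rightarrow> bool" (infix "\<preceq>" 50) and less :: "'b \<Rightarrow> 'b \<Rightarrow> bool" (infix "\<prec>" 50) +
  fixes K :: "'b set" and l :: "'a rel"
  assumes down: "y \<in> K \<Longrightarrow> x \<prec> y \<Longrightarrow> x \<in> K"
    and small: "a \<in> K \<Longrightarrow> |{x. x \<prec> a}| \<le>o l"
    and bounded: "A \<subseteq> K \<Longrightarrow> |A| \<le>o l \<Longrightarrow> \<exists>b\<in>K. \<forall>a\<in>A. a \<prec> b"
    and card_l: "Card_order l"
    and uncountable_l: "natLeq <o l"
    and pigeonhole_l: "P \<subseteq> Field l \<Longrightarrow> |P| <o l \<Longrightarrow> p ` Field l \<subseteq> P \<Longrightarrow> \<exists>y. \<not> |{i\<in>Field l. p i = y}| <o l"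
begin

definition below :: "'b \<Rightarrow> 'b set"
  where "below a = {x. x \<prec> a}"

text \<open>\<open>b\<close> is a nonzero limit point of \<open>C\<close>, whether or not it belongs to \<open>C\<close>.\<close>
definition lp :: "'b set \<Rightarrow> 'b \<Rightarrow> bool"
  where "lp C b \<longleftrightarrow> (\<exists>x. x \<prec> b) \<and> (\<forall>x. x \<prec> b \<longrightarrow> (\<exists>y\<in>C. x \<prec> y \<and> y \<prec> b))"

definition club :: "'b set \<Rightarrow> bool"
  where "club D \<longleftrightarrow> D \<subseteq> K \<and> (\<forall>b\<in>K. \<exists>c\<in>D. b \<preceq> c) \<and> (\<forall>b\<in>K. lp D b \<longrightarrow> b \<in> D)"

definition stationary :: "'b set \<Rightarrow> bool"
  where "stationary S \<longleftrightarrow> S \<subseteq> K \<and> (\<forall>D. club D \<longrightarrow> (\<exists>a\<in>S. a \<in> D))"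

lemma mem_below [simp]: "x \<in> below a \<longleftrightarrow> x \<prec> a"
  by (simp add: below_def)

lemma below_sub_K: "a \<in> K \<Longrightarrow> below a \<subseteq> K"
  using down by auto

lemma card_below: "a \<in> K \<Longrightarrow> |below a| \<le>o l"
  using small by (simp add: below_def)

lemma ex_least: "P a \<Longrightarrow> \<exists>m. P m \<and> (\<forall>x. P x \<longrightarrow> m \<preceq> x)"
  by (metis LeastI Least_le)

lemma Cinfinite_l: "Cinfinite l"
  using card_l uncountable_l natLeq_cinfinite cinfinite_mono ordLess_imp_ordLeq by blast

lemma card_Field_l: "|Field l| =o l"
  using card_l by (rule card_of_Field_ordIso)

lemma finite_le_l: "finite A \<Longrightarrow> |A| \<le>o l"
  by (meson finite_iff_ordLess_natLeq ordLess_imp_ordLeq ordLess_transitive uncountable_l)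

lemma image_le_l: "|A| \<le>o l \<Longrightarrow> |f ` A| \<le>o l"
  using card_of_image ordLeq_transitive by blast

lemma Un_le_l: "|A| \<le>o l \<Longrightarrow> |B| \<le>o l \<Longrightarrow> |A \<union> B| \<le>o l"
  using Cinfinite_l by (rule Un_Cinfinite_bound[rotated 2])

lemma UN_le_l: "|I| \<le>o l \<Longrightarrow> (\<And>i. i \<in> I \<Longrightarrow> |A i| \<le>o l) \<Longrightarrow> |\<Union>i\<in>I. A i| \<le>o l"
  using Cinfinite_l by (intro UNION_Cinfinite_bound) auto

lemma subset_le_l: "A \<subseteq> B \<Longrightarrow> |B| \<le>o l \<Longrightarrow> |A| \<le>o l"
  using card_of_mono1 ordLeq_transitive by blast

lemma ex_above: "a \<in> K \<Longrightarrow> \<exists>b\<in>K. a \<prec> b"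
  using bounded[of "{a}"] finite_le_l[of "{a}"] by auto

lemma ex_above2: "a \<in> K \<Longrightarrow> a' \<in> K \<Longrightarrow> \<exists>b\<in>K. a \<prec> b \<and> a' \<prec> b"
  using bounded[of "{a, a'}"] finite_le_l[of "{a, a'}"] by auto

lemma K_nonempty: "\<exists>a. a \<in> K"
  using bounded[of "{}"] finite_le_l[of "{}"] by auto

lemma bounded_image: "|I| \<le>o l \<Longrightarrow> (\<And>i. i \<in> I \<Longrightarrow> n i \<in> K) \<Longrightarrow> \<exists>b\<in>K. \<forall>i\<in>I. n i \<prec> b"
  using bounded[of "n ` I"] image_le_l by (metis imageE imageI subsetI)

lemma ex_image_bound:
  assumes "b \<in> K" "\<And>x. x \<prec> b \<Longrightarrow> |A x| \<le>o l" "\<And>x. x \<prec> b \<Longrightarrow> A x \<subseteq> K"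
  shows "\<exists>c\<in>K. \<forall>x. x \<prec> b \<longrightarrow> (\<forall>a\<in>A x. a \<prec> c)"
proof -
  have "|\<Union>x\<in>below b. A x| \<le>o l"
    using assms by (intro UN_le_l card_below) auto
  then show ?thesis
    using bounded[of "\<Union>x\<in>below b. A x"] assms(3) by fastforce
qed

lemma lpD: "lp C b \<Longrightarrow> x \<prec> b \<Longrightarrow> \<exists>y\<in>C. x \<prec> y \<and> y \<prec> b"
  by (auto simp: lp_def)

lemma lp_nonzero: "lp C b \<Longrightarrow> \<exists>x. x \<prec> b"
  by (auto simp: lp_def)

lemma lp_mono: "lp C b \<Longrightarrow> C \<subseteq> D \<Longrightarrow> lp D b"
  unfolding lp_def by blast

text \<open>The usual source of clubs below. A bound for \<open>g\<close> on initial segments is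
  iterated countably often; the supremum of the iterates stays in \<open>K\<close> because countable
  sets have size at most \<open>l\<close>.\<close>

lemma club_closure:
  assumes g: "\<And>x. x \<in> K \<Longrightarrow> g x \<in> K"
  shows "club {d\<in>K. (\<exists>x. x \<prec> d) \<and> (\<forall>x. x \<prec> d \<longrightarrow> g x \<prec> d)}" (is "club ?D")
  unfolding club_def
proof (intro conjI ballI impI)
  fix b assume b: "b \<in> K"
  have "\<exists>b'\<in>K. b \<prec> b' \<and> (\<forall>x. x \<prec> b \<longrightarrow> g x \<prec> b')" if b: "b \<in> K" for b
  proof -
    have "\<exists>c\<in>K. \<forall>x. x \<prec> b \<longrightarrow> (\<forall>a\<in>{g x}. a \<prec> c)"
      using g down[OF b] by (intro ex_image_bound b finite_le_l) auto
    then obtain c where c: "c \<in> K" "\<forall>x. x \<prec> b \<longrightarrow> g x \<prec> c"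
      by blast
    then show ?thesis
      using ex_above2[OF b c(1)] less_trans by blast
  qed
  then obtain n where n: "\<And>b. b \<in> K \<Longrightarrow> n b \<in> K \<and> b \<prec> n b \<and> (\<forall>x. x \<prec> b \<longrightarrow> g x \<prec> n b)"
    by metis
  define s where "s = rec_nat b (\<lambda>_. n)"
  have s_simps: "s 0 = b" "\<And>i. s (Suc i) = n (s i)"
    by (simp_all add: s_def)
  have sK: "s i \<in> K" for i
    by (induction i) (use b n in \<open>auto simp: s_simps\<close>)
  have "|range s| \<le>o l"
    by (intro image_le_l) (meson card_of_nat ordIso_ordLess_trans ordLess_imp_ordLeq uncountable_l)
  then obtain u where "u \<in> K" "\<forall>i. s i \<prec> u"
    using bounded[of "range s"] sK by auto
  then obtain d where d: "\<forall>i. s i \<prec> d" "\<And>x. (\<forall>i. s i \<prec> x) \<Longrightarrow> d \<preceq> x"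
    using ex_least[of "\<lambda>d. \<forall>i. s i \<prec> d" u] by blast
  have dK: "d \<in> K"
    using d(2)[of u] \<open>u \<in> K\<close> \<open>\<forall>i. s i \<prec> u\<close> down le_less by metis
  have "g x \<prec> d" if "x \<prec> d" for x
  proof -
    obtain i where "x \<preceq> s i"
      using d(2)[of x] \<open>x \<prec> d\<close> by (meson leD leI)
    then have "x \<prec> s (Suc i)"
      using n[OF sK[of i]] le_less_trans s_simps by metis
    then show ?thesis
      using n[OF sK[of "Suc i"]] d(1) s_simps less_trans by metis
  qed
  then have "d \<in> ?D"
    using dK d(1) by auto
  moreover have "b \<preceq> d"
    using d(1) s_simps(1) less_imp_le by metis
  ultimately show "\<exists>c\<in>?D. b \<preceq> c"
    by blast
next
  fix b assume "b \<in> K" and lp: "lp ?D b"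
  have "g x \<prec> b" if "x \<prec> b" for x
  proof -
    obtain y where "y \<in> ?D" "x \<prec> y" "y \<prec> b"
      using lpD[OF lp \<open>x \<prec> b\<close>] by blast
    then show ?thesis
      using less_trans by blast
  qed
  then show "b \<in> ?D"
    using lp_nonzero[OF lp] \<open>b \<in> K\<close> by blast
qed auto

lemma clubD:
  assumes "club D"
  shows "D \<subseteq> K" "b \<in> K \<Longrightarrow> \<exists>c\<in>D. b \<prec> c" "b \<in> K \<Longrightarrow> lp D b \<Longrightarrow> b \<in> D"
proof -
  show "\<exists>c\<in>D. b \<prec> c" if "b \<in> K"
    using ex_above[OF that] assms less_le_trans unfolding club_def by blast
qed (use assms in \<open>auto simp: club_def\<close>)

text \<open>Let \<open>g\<close> move each \<open>x\<close> past a further element of every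
  \<open>D i\<close>. A closure point of \<open>g\<close> is then a limit point of all
  \<open>D i\<close> at once.\<close>

lemma club_Inter:
  assumes I: "|I| \<le>o l" and D: "\<And>i. i \<in> I \<Longrightarrow> club (D i)"
  shows "club (K \<inter> (\<Inter>i\<in>I. D i))"
  unfolding club_def
proof (intro conjI ballI impI)
  fix b assume b: "b \<in> K"
  have "\<exists>c\<in>K. \<forall>i\<in>I. \<exists>d\<in>D i. x \<prec> d \<and> d \<prec> c" if x: "x \<in> K" for x
  proof -
    obtain n where n: "\<And>i. i \<in> I \<Longrightarrow> n i \<in> D i \<and> x \<prec> n i"
      using clubD(2)[OF D x] by metis
    then have "n ` I \<subseteq> K"
      using clubD(1)[OF D] by blast
    then obtain c where "c \<in> K" "\<forall>a\<in>n ` I. a \<prec> c"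
      using bounded image_le_l[OF I] by metis
    then show ?thesis
      using n by (meson imageI)
  qed
  then obtain g where g: "\<And>x. x \<in> K \<Longrightarrow> g x \<in> K \<and> (\<forall>i\<in>I. \<exists>d\<in>D i. x \<prec> d \<and> d \<prec> g x)"
    by metis
  obtain c where c: "b \<preceq> c" "c \<in> K" "\<exists>x. x \<prec> c" "\<And>x. x \<prec> c \<Longrightarrow> g x \<prec> c"
    using club_closure[of g] g b unfolding club_def by blast
  have "lp (D i) c" if "i \<in> I" for i
    unfolding lp_def
  proof (intro conjI allI impI c(3))
    fix x assume "x \<prec> c"
    then show "\<exists>y\<in>D i. x \<prec> y \<and> y \<prec> c"
      using g[OF down[OF c(2)], of x] c(4)[of x] that less_trans by blast
  qed
  then show "\<exists>c\<in>K \<inter> (\<Inter>i\<in>I. D i). b \<preceq> c"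
    using c clubD(3)[OF D] by blast
next
  fix b assume "b \<in> K" "lp (K \<inter> (\<Inter>i\<in>I. D i)) b"
  moreover have "lp (D i) b" if "i \<in> I" for i
    using \<open>lp _ b\<close> by (rule lp_mono) (use that in blast)
  ultimately show "b \<in> K \<inter> (\<Inter>i\<in>I. D i)"
    using clubD(3)[OF D] by blast
qed auto

lemma club_Int:
  assumes "club D" "club D'"
  shows "club (D \<inter> D')"
proof -
  have "club (K \<inter> (\<Inter>b\<in>UNIV. if b then D else D'))"
    using assms by (intro club_Inter finite_le_l) auto
  also have "K \<inter> (\<Inter>b\<in>UNIV. if b then D else D') = D \<inter> D'"
    using clubD(1)[OF assms(1)] by (auto simp: UNIV_bool)
  finally show ?thesis .
qed

lemma club_stationary_Int:
  assumes "stationary S" "club D"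
  shows "stationary (S \<inter> D)"
  using assms club_Int unfolding stationary_def by blast

text \<open>A weak Fodor lemma, asking only for an unbounded fibre. If each fibre over
  \<open>e\<close> were bounded by \<open>g e\<close>, a point of \<open>S\<close> closed under
  \<open>g\<close> would exceed the bound of its own fibre.\<close>

lemma stationary_regressive:
  assumes S: "stationary S" and f: "\<And>a. a \<in> S \<Longrightarrow> f a \<prec> a"
  shows "\<exists>e\<in>K. \<forall>b\<in>K. \<exists>a\<in>S. b \<prec> a \<and> f a = e"
proof (rule ccontr)
  assume "\<not> ?thesis"
  then obtain g where g: "\<And>e. e \<in> K \<Longrightarrow> g e \<in> K \<and> (\<forall>a\<in>S. f a = e \<longrightarrow> \<not> g e \<prec> a)"
    by metis
  then obtain a where "a \<in> S" "\<And>x. x \<prec> a \<Longrightarrow> g x \<prec> a"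
    using S club_closure[of g] unfolding stationary_def by blast
  moreover have "a \<in> K" using S \<open>a \<in> S\<close> by (auto simp: stationary_def)
  ultimately show False
    using f[of a] g[of "f a"] down by blast
qed

definition limit :: "'b \<Rightarrow> bool"
  where "limit a \<longleftrightarrow> a \<in> K \<and> lp K a"

lemma limitD: "limit a \<Longrightarrow> a \<in> K" "limit a \<Longrightarrow> x \<prec> a \<Longrightarrow> \<exists>y. x \<prec> y \<and> y \<prec> a" "limit a \<Longrightarrow> \<exists>x. x \<prec> a"
  by (auto simp: limit_def lp_def)

lemma lp_limit: "lp C a \<Longrightarrow> C \<subseteq> K \<Longrightarrow> a \<in> K \<Longrightarrow> limit a"
  unfolding limit_def using lp_mono by blast

lemma club_limit: "club {a. limit a}"
proof -
  obtain g where g: "\<And>x. x \<in> K \<Longrightarrow> g x \<in> K \<and> x \<prec> g x"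
    using ex_above by metis
  have 1: "club {d\<in>K. (\<exists>x. x \<prec> d) \<and> (\<forall>x. x \<prec> d \<longrightarrow> g x \<prec> d)}" (is "club ?D")
    using g by (intro club_closure) auto
  have 2: "?D \<subseteq> {a. limit a}"
    unfolding limit_def lp_def using g down by blast
  show ?thesis
    unfolding club_def
  proof (intro conjI ballI impI)
    fix b assume "b \<in> K" then show "\<exists>c\<in>{a. limit a}. b \<preceq> c"
      using 1 2 unfolding club_def by (meson subsetD)
  next
    fix b assume "b \<in> K" and "lp {a. limit a} b"
    then show "b \<in> {a. limit a}"
      using lp_mono[of "{a. limit a}" b K] by (auto simp: limit_def)
  qed (auto simp: limit_def)
qed

lemma zero_suc_limit:
  assumes "a \<in> K"
  obtains (zero) "\<And>x. \<not> x \<prec> a" | (suc) b where "b \<prec> a" "\<And>x. x \<prec> a \<Longrightarrow> x \<preceq> b" | (limit) "limit a"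
proof -
  consider "\<And>x. \<not> x \<prec> a" | b where "b \<prec> a" "\<And>x. x \<prec> a \<Longrightarrow> x \<preceq> b"
    | "\<exists>x. x \<prec> a" "\<forall>b. b \<prec> a \<longrightarrow> (\<exists>x. x \<prec> a \<and> \<not> x \<preceq> b)" by metis
  then show thesis
  proof cases
    case 3
    then have "limit a"
      using assms down unfolding limit_def lp_def by (meson not_le)
    then show ?thesis using that by blast
  qed (use that in blast)+
qed

lemma ex_suc:
  assumes "a \<in> K"
  shows "\<exists>b\<in>K. a \<prec> b \<and> (\<forall>x. x \<prec> b \<longrightarrow> x \<preceq> a)"
proof -
  obtain c where "c \<in> K" "a \<prec> c" using ex_above[OF assms] by blast
  obtain b where b: "a \<prec> b" "\<And>x. a \<prec> x \<Longrightarrow> b \<preceq> x"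
    using ex_least[of "\<lambda>b. a \<prec> b" c] \<open>a \<prec> c\<close> by blast
  have "b \<in> K"
    using b(2)[OF \<open>a \<prec> c\<close>] \<open>c \<in> K\<close> down le_less by metis
  then show ?thesis
    using b by (meson leD leI)
qed

text \<open>Meaningful only if \<open>E\<close> is closed and has an element \<open>\<preceq> v\<close>.\<close>
definition last_in :: "'b set \<Rightarrow> 'b \<Rightarrow> 'b"
  where "last_in E v = (SOME m. m \<in> E \<and> m \<preceq> v \<and> (\<forall>x\<in>E. x \<preceq> v \<longrightarrow> x \<preceq> m))"

text \<open>The least upper bound of the elements of \<open>E\<close> up to \<open>v\<close> is a
  member of \<open>E\<close> or a limit point of \<open>E\<close>.\<close>

lemma ex_last:
  assumes closed: "\<And>b. b \<preceq> v \<Longrightarrow> lp E b \<Longrightarrow> b \<in> E" and "x \<in> E" "x \<preceq> v"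
  shows "\<exists>m. m \<in> E \<and> m \<preceq> v \<and> (\<forall>x\<in>E. x \<preceq> v \<longrightarrow> x \<preceq> m)"
proof -
  obtain m where m: "\<forall>x\<in>E. x \<preceq> v \<longrightarrow> x \<preceq> m" "\<And>m'. (\<forall>x\<in>E. x \<preceq> v \<longrightarrow> x \<preceq> m') \<Longrightarrow> m \<preceq> m'"
    using ex_least[of "\<lambda>m. \<forall>x\<in>E. x \<preceq> v \<longrightarrow> x \<preceq> m" v] by blast
  have mv: "m \<preceq> v" using m(2) by blast
  have "m \<in> E"
  proof (rule ccontr)
    assume "m \<notin> E"
    have "x \<prec> m" using m(1) assms(2,3) \<open>m \<notin> E\<close> by (metis le_less)
    have "\<exists>z\<in>E. y \<prec> z \<and> z \<prec> m" if "y \<prec> m" for y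
    proof -
      obtain z where "z \<in> E" "z \<preceq> v" "\<not> z \<preceq> y"
        using m(2)[of y] \<open>y \<prec> m\<close> by (meson leD)
      then show ?thesis
        using m(1) \<open>m \<notin> E\<close> by (metis le_less not_le)
    qed
    then have "lp E m"
      using \<open>x \<prec> m\<close> by (auto simp: lp_def)
    then show False
      using closed[OF mv] \<open>m \<notin> E\<close> by blast
  qed
  then show ?thesis
    using m mv by blast
qed

lemma last_in:
  assumes "club E" "x \<in> E" "x \<preceq> v" "v \<in> K"
  shows "last_in E v \<in> E" "last_in E v \<preceq> v" "y \<in> E \<Longrightarrow> y \<preceq> v \<Longrightarrow> y \<preceq> last_in E v"
proof -
  have "b \<in> K" if "b \<preceq> v" for b using that assms(4) down le_less by metis
  then have "\<exists>m. m \<in> E \<and> m \<preceq> v \<and> (\<forall>x\<in>E. x \<preceq> v \<longrightarrow> x \<preceq> m)"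
    using ex_last[of v E x] clubD(3)[OF assms(1)] assms by blast
  from someI_ex[OF this]
  show "last_in E v \<in> E" "last_in E v \<preceq> v" "y \<in> E \<Longrightarrow> y \<preceq> v \<Longrightarrow> y \<preceq> last_in E v"
    unfolding last_in_def by blast+
qed

end

subsection \<open>Gaps of the square sequence\<close>

definition (in succ_card) consecutive :: "'b set \<Rightarrow> 'b \<Rightarrow> 'b \<Rightarrow> bool"
  where "consecutive C u v \<longleftrightarrow> u \<in> C \<and> v \<in> C \<and> u \<prec> v \<and> (\<forall>w\<in>C. u \<prec> w \<longrightarrow> v \<preceq> w)"

locale square_card = succ_card less_eq less K l
  for less_eq :: "'b \<Rightarrow> 'b \<Rightarrow> bool" (infix "\<preceq>" 50) and less :: "'b \<Rightarrow> 'b \<Rightarrow> bool" (infix "\<prec>" 50)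
    and K :: "'b set" and l :: "'a rel" +
  fixes \<C> :: "'b \<Rightarrow> 'b set set" and S :: "'b set"
  assumes sq_nonempty: "limit a \<Longrightarrow> \<C> a \<noteq> {}"
    and sq_sub: "limit a \<Longrightarrow> C \<in> \<C> a \<Longrightarrow> C \<subseteq> below a"
    and sq_unbounded: "limit a \<Longrightarrow> C \<in> \<C> a \<Longrightarrow> b \<prec> a \<Longrightarrow> \<exists>c\<in>C. b \<preceq> c"
    and sq_closed: "limit a \<Longrightarrow> C \<in> \<C> a \<Longrightarrow> b \<prec> a \<Longrightarrow> lp C b \<Longrightarrow> b \<in> C"
    and sq_card: "limit a \<Longrightarrow> |\<C> a| \<le>o l"
    and sq_coherent: "limit a \<Longrightarrow> C \<in> \<C> a \<Longrightarrow> b \<in> C \<Longrightarrow> lp C b \<Longrightarrow> C \<inter> below b \<in> \<C> b"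
    and sq_nontrivial: "club D \<Longrightarrow> \<exists>a\<in>D. lp D a \<and> D \<inter> below a \<notin> \<C> a"
    and S_stationary: "stationary S"
    and S_limit: "a \<in> S \<Longrightarrow> limit a"
    and S_cofinal: "a \<in> S \<Longrightarrow> \<exists>A. |A| <o l \<and> A \<subseteq> below a \<and> (\<forall>b. b \<prec> a \<longrightarrow> (\<exists>c\<in>A. b \<preceq> c))"
    and S_card: "a \<in> S \<Longrightarrow> |\<C> a| <o l"
begin

lemma sq_unbounded_strict:
  assumes "limit a" "C \<in> \<C> a" "b \<prec> a"
  shows "\<exists>c\<in>C. b \<prec> c"
proof -
  obtain b' where "b \<prec> b'" "b' \<prec> a" using limitD(2)[OF assms(1,3)] by blast
  then show ?thesis
    using sq_unbounded[OF assms(1,2)] less_le_trans by blast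
qed

lemma sq_less: "limit a \<Longrightarrow> C \<in> \<C> a \<Longrightarrow> c \<in> C \<Longrightarrow> c \<prec> a"
  using sq_sub by (meson mem_below subsetD)

lemma S_K: "a \<in> S \<Longrightarrow> a \<in> K"
  using S_stationary unfolding stationary_def by blast

text \<open>The gap is obtained by cutting \<open>C\<close> at \<open>x\<close>. There is a last
  element of \<open>C\<close> before \<open>x\<close>, since otherwise \<open>x\<close> would be a
  limit point of the closed set \<open>C\<close>.\<close>

lemma consecutive_around:
  assumes a: "limit a" and C: "C \<in> \<C> a" and c: "c \<in> C" "c \<prec> x" and x: "x \<prec> a"
    and nacc: "\<not> (x \<in> C \<and> lp C x)"
  shows "\<exists>u v. consecutive C u v \<and> c \<preceq> u \<and> u \<prec> x \<and> x \<preceq> v"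
proof -
  obtain v where v: "v \<in> C \<and> x \<preceq> v" "\<And>w. w \<in> C \<and> x \<preceq> w \<Longrightarrow> v \<preceq> w"
    using sq_unbounded[OF a C x] ex_least[of "\<lambda>w. w \<in> C \<and> x \<preceq> w"] by blast
  have "\<exists>m. m \<in> C \<inter> below x \<and> m \<preceq> x \<and> (\<forall>y\<in>C \<inter> below x. y \<preceq> x \<longrightarrow> y \<preceq> m)"
  proof (rule ex_last)
    fix b assume b: "b \<preceq> x" and lp: "lp (C \<inter> below x) b"
    have "lp C b" using lp by (rule lp_mono) blast
    then have "b \<in> C"
      using sq_closed[OF a C] b x le_less_trans by blast
    moreover have "b \<noteq> x"
      using nacc \<open>lp C b\<close> \<open>b \<in> C\<close> by blast
    ultimately show "b \<in> C \<inter> below x"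
      using b le_less by auto
  qed (use c less_imp_le in auto)
  then obtain u where u: "u \<in> C" "u \<prec> x" "\<And>y. y \<in> C \<Longrightarrow> y \<prec> x \<Longrightarrow> y \<preceq> u"
    using less_imp_le by auto
  have "consecutive C u v"
    unfolding consecutive_def using u v by (metis less_le_trans not_le)
  then show ?thesis
    using u v c by blast
qed

text \<open>A Kurepa argument: a tree all of whose levels have fewer than \<open>l\<close> nodes would thread the
  square sequence.\<close>
lemma club_meets_gaps:
  assumes E: "club E"
  shows "\<exists>a\<in>S. \<forall>C\<in>\<C> a. \<forall>e. e \<prec> a \<longrightarrow>
    (\<exists>u v. consecutive C u v \<and> e \<prec> u \<and> (\<exists>x\<in>E. u \<prec> x \<and> x \<preceq> v))"
proof (rule ccontr)
  assume "\<not> ?thesis"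
  then obtain C0 e0 where C0: "\<And>a. a \<in> S \<Longrightarrow> C0 a \<in> \<C> a \<and> e0 a \<prec> a \<and>
    \<not> (\<exists>u v. consecutive (C0 a) u v \<and> e0 a \<prec> u \<and> (\<exists>x\<in>E. u \<prec> x \<and> x \<preceq> v))"
    by metis
  \<comment> \<open>Failure at \<open>a\<close> means that a tail of \<open>E\<close> below
    \<open>a\<close> consists of accumulation points of \<open>C0 a\<close>; coherence can be
    applied at each of them.\<close>
  have "\<exists>e. e \<prec> a \<and> (\<forall>x\<in>E. e \<prec> x \<longrightarrow> x \<prec> a \<longrightarrow> x \<in> C0 a \<and> lp (C0 a) x)" if a: "a \<in> S" for a
  proof -
    note lim = S_limit[OF a]
    obtain c where c: "c \<in> C0 a" "e0 a \<prec> c"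
      using sq_unbounded_strict[OF lim] C0[OF a] by blast
    moreover have "x \<in> C0 a \<and> lp (C0 a) x" if "x \<in> E" "c \<prec> x" "x \<prec> a" for x
      using consecutive_around[OF lim _ c(1) that(2,3)] C0[OF a] that(1) c(2) less_le_trans by blast
    ultimately show ?thesis
      using sq_less[OF lim] C0[OF a] by blast
  qed
  then obtain e1 where e1: "\<And>a. a \<in> S \<Longrightarrow> e1 a \<prec> a"
    "\<And>a x. a \<in> S \<Longrightarrow> x \<in> E \<Longrightarrow> e1 a \<prec> x \<Longrightarrow> x \<prec> a \<Longrightarrow> x \<in> C0 a \<and> lp (C0 a) x"
    by metis
  \<comment> \<open>Intersecting \<open>S\<close> with \<open>E\<close> puts the points of
    \<open>H\<close> themselves among the levels considered, as \<open>W_card\<close>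
    requires.\<close>
  obtain e where e: "e \<in> K" "\<And>b. b \<in> K \<Longrightarrow> \<exists>a\<in>S \<inter> E. b \<prec> a \<and> e1 a = e"
    using stationary_regressive[OF club_stationary_Int[OF S_stationary E], of e1] e1(1) by blast
  define H where "H = {a\<in>S \<inter> E. e1 a = e}"
  have H: "\<And>b. b \<in> K \<Longrightarrow> \<exists>a\<in>H. b \<prec> a" and HS: "\<And>a. a \<in> H \<Longrightarrow> a \<in> S" "\<And>a. a \<in> H \<Longrightarrow> a \<in> E"
    and He: "\<And>a. a \<in> H \<Longrightarrow> e \<prec> a"
    using e e1(1) unfolding H_def by auto
  have acc: "x \<in> C0 a \<and> lp (C0 a) x" if "a \<in> H" "x \<in> E" "e \<prec> x" "x \<prec> a" for a x
    using that e1(2) unfolding H_def by blast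
  have EK: "x \<in> K" if "x \<in> E" for x
    using clubD(1)[OF E] that by blast
  have inC: "C0 a \<inter> below x \<in> \<C> x" if "a \<in> H" "x \<in> E" "e \<prec> x" "x \<prec> a" for a x
    using sq_coherent[OF S_limit] HS that acc C0 by blast
  have lim: "limit x" if x: "x \<in> E" "e \<prec> x" for x
  proof -
    obtain a where a: "a \<in> H" "x \<prec> a" using H[OF EK[OF x(1)]] by blast
    have "C0 a \<subseteq> K"
      using sq_sub[OF S_limit[OF HS(1)[OF a(1)]]] C0[OF HS(1)[OF a(1)]] below_sub_K S_K[OF HS(1)[OF a(1)]] by blast
    then show ?thesis
      using lp_limit acc[OF a(1) x a(2)] EK[OF x(1)] by blast
  qed
  \<comment> \<open>The levels of the Kurepa tree. Only traces that recur for unboundedly many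
    \<open>a\<close> are kept, so that every node extends to every higher level in
    \<open>E\<close>.\<close>
  define W where "W x = {w. \<forall>b\<in>K. \<exists>a\<in>H. b \<prec> a \<and> x \<prec> a \<and> C0 a \<inter> below x = w}" for x
  have W_sq: "w \<in> \<C> x" if "x \<in> E" "e \<prec> x" "w \<in> W x" for x w
    using that inC e(1) unfolding W_def by blast
  have cut: "A \<inter> below x \<inter> below y = A \<inter> below y" if "y \<preceq> x" for A x y
    using that less_le_trans by auto
  have W_down: "w \<inter> below y \<in> W y" if "w \<in> W x" "y \<preceq> x" for w x y
    unfolding W_def
  proof (intro CollectI ballI)
    fix b assume "b \<in> K"
    then obtain a where "a \<in> H" "b \<prec> a" "x \<prec> a" "C0 a \<inter> below x = w"
      using \<open>w \<in> W x\<close> unfolding W_def by blast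
    then show "\<exists>a\<in>H. b \<prec> a \<and> y \<prec> a \<and> C0 a \<inter> below y = w \<inter> below y"
      using cut[OF \<open>y \<preceq> x\<close>, of "C0 a"] le_less_trans[OF \<open>y \<preceq> x\<close>] by blast
  qed
  \<comment> \<open>\<open>K\<close> is not a union of \<open>l\<close> bounded sets, and
    \<open>\<C> y\<close> leaves at most \<open>l\<close> possible traces on \<open>below y\<close>;
    so some trace recurs unboundedly among the \<open>a\<close> with \<open>P a\<close>.\<close>
  have ext: "\<exists>w\<in>W y. \<exists>a\<in>H. y \<prec> a \<and> C0 a \<inter> below y = w \<and> P a"
    if y: "y \<in> E" "e \<prec> y" and P: "\<And>b. b \<in> K \<Longrightarrow> \<exists>a\<in>H. b \<prec> a \<and> P a" for y P
  proof (rule ccontr)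
    assume neg: "\<not> ?thesis"
    define G where "G w = {a\<in>H. y \<prec> a \<and> C0 a \<inter> below y = w \<and> P a}" for w
    have "\<exists>b\<in>K. \<forall>a\<in>G w. \<not> b \<prec> a" for w
    proof (cases "G w = {}")
      case True
      then show ?thesis using e(1) by blast
    next
      case False
      then have "w \<notin> W y" using neg unfolding G_def by blast
      then obtain b where "b \<in> K" "\<forall>a\<in>H. \<not> (b \<prec> a \<and> y \<prec> a \<and> C0 a \<inter> below y = w)"
        unfolding W_def by blast
      then show ?thesis unfolding G_def by blast
    qed
    then obtain n where n: "\<And>w. n w \<in> K \<and> (\<forall>a\<in>G w. \<not> n w \<prec> a)"
      by metis
    obtain b where b: "b \<in> K" "\<And>w. w \<in> \<C> y \<Longrightarrow> n w \<prec> b"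
      using bounded_image[OF sq_card[OF lim[OF y]], of n] n by metis
    obtain c where "c \<in> K" "b \<prec> c" "y \<prec> c" using ex_above2[OF b(1) EK[OF y(1)]] by blast
    then obtain a where a: "a \<in> H" "c \<prec> a" "P a" using P by blast
    then have "y \<prec> a" "b \<prec> a" using \<open>b \<prec> c\<close> \<open>y \<prec> c\<close> less_trans by blast+
    then have "a \<in> G (C0 a \<inter> below y)" "C0 a \<inter> below y \<in> \<C> y"
      using a inC y unfolding G_def by auto
    then show False
      using n b(2) \<open>b \<prec> a\<close> less_trans by blast
  qed
  have W_ext: "\<exists>w'\<in>W y. w' \<inter> below x = w" if "w \<in> W x" "x \<preceq> y" "y \<in> E" "e \<prec> y" for x y w
  proof -
    have "\<exists>a\<in>H. b \<prec> a \<and> C0 a \<inter> below x = w" if "b \<in> K" for b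
      using \<open>w \<in> W x\<close> that unfolding W_def by blast
    then show ?thesis
      using ext[OF that(3,4), of "\<lambda>a. C0 a \<inter> below x = w"] cut[OF that(2)] by metis
  qed
  have W_nonempty: "\<exists>w. w \<in> W y" if "y \<in> E" "e \<prec> y" for y
    using ext[OF that, of "\<lambda>_. True"] H by blast
  \<comment> \<open>\<open>W x\<close> consists of restrictions of members of \<open>W a\<close> for
    any higher \<open>a \<in> H\<close>, and \<open>W a \<subseteq> \<C> a\<close> has fewer than
    \<open>l\<close> elements because \<open>a \<in> S\<close>.\<close>
  have W_card: "|W x| <o l" if x: "x \<in> E" "e \<prec> x" for x
  proof -
    obtain a where a: "a \<in> H" "x \<prec> a" using H[OF EK[OF x(1)]] by blast
    have "W x \<subseteq> (\<lambda>c. c \<inter> below x) ` \<C> a"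
    proof
      fix w assume "w \<in> W x"
      then obtain w' where "w' \<in> W a" "w' \<inter> below x = w"
        using W_ext[of w x a] a HS He less_imp_le by blast
      then show "w \<in> (\<lambda>c. c \<inter> below x) ` \<C> a"
        using W_sq[of a w'] a HS He by blast
    qed
    then show ?thesis
      using S_card[OF HS(1)[OF a(1)]] card_of_image card_of_mono1 ordLeq_ordLess_trans by metis
  qed
  \<comment> \<open>A node that never splits carries a unique branch. The union of the branch is a
    club whose traces at its accumulation points all lie in \<open>\<C>\<close>, contrary to
    \<open>sq_nontrivial\<close>.\<close>
  have split: "\<exists>y\<in>E. x \<prec> y \<and> (\<exists>w1\<in>W y. \<exists>w2\<in>W y. w1 \<noteq> w2 \<and> w1 \<inter> below x = w \<and> w2 \<inter> below x = w)"
    if x: "x \<in> E" "e \<prec> x" and w: "w \<in> W x" for x w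
  proof (rule ccontr)
    assume neg: "\<not> ?thesis"
    have uniq: "w1 = w2" if "y \<in> E" "x \<prec> y" "w1 \<in> W y" "w2 \<in> W y" "w1 \<inter> below x = w" "w2 \<inter> below x = w"
      for y w1 w2
      using neg that by blast
    have "\<exists>w'. w' \<in> W y \<and> w' \<inter> below x = w" if "y \<in> E" "x \<prec> y" for y
      using W_ext[OF w less_imp_le[OF that(2)] that(1)] x(2) that(2) less_trans by blast
    then obtain t where t: "\<And>y. y \<in> E \<Longrightarrow> x \<prec> y \<Longrightarrow> t y \<in> W y \<and> t y \<inter> below x = w"
      by metis
    have t_coh: "t y \<inter> below z = t z" if "y \<in> E" "z \<in> E" "x \<prec> z" "z \<preceq> y" for y z
    proof -
      have "x \<prec> y" using that less_le_trans by blast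
      then show ?thesis
        using uniq[OF that(2,3) W_down[of "t y" y z]] t[OF that(1)] t[OF that(2,3)] that(4)
          cut[of x z "t y"] less_imp_le[OF that(3)] by simp
    qed
    have t_sq: "limit y" "t y \<in> \<C> y" if "y \<in> E" "x \<prec> y" for y
      using lim[of y] W_sq[of y] t[OF that] that x(2) less_trans by blast+
    define D where "D = (\<Union>y\<in>{y\<in>E. x \<prec> y}. t y)"
    have D_below: "D \<inter> below y = t y" if y: "y \<in> E" "x \<prec> y" for y
    proof
      show "D \<inter> below y \<subseteq> t y"
      proof
        fix z assume "z \<in> D \<inter> below y"
        then obtain y' where y': "y' \<in> E" "x \<prec> y'" "z \<in> t y'" "z \<prec> y" unfolding D_def by auto
        show "z \<in> t y"
        proof (cases "y' \<preceq> y")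
          case True
          then have "t y \<inter> below y' = t y'"
            using t_coh[OF y(1) y'(1,2)] by metis
          then show ?thesis using y'(3) by blast
        next
          case False
          then have "t y' \<inter> below y = t y"
            using t_coh[OF y'(1) y] by (meson linear)
          then show ?thesis using y'(3,4) mem_below by blast
        qed
      qed
      show "t y \<subseteq> D \<inter> below y"
        using sq_sub t_sq[OF y] y unfolding D_def by blast
    qed
    have above: "\<exists>y\<in>E. b \<prec> y \<and> x \<prec> y" if b: "b \<in> K" for b
    proof -
      obtain c where "c \<in> K" "b \<prec> c" "x \<prec> c" using ex_above2[OF b EK[OF x(1)]] by blast
      then show ?thesis using clubD(2)[OF E, of c] less_trans by blast
    qed
    have "club D"
      unfolding club_def
    proof (intro conjI ballI impI)
      show "D \<subseteq> K"
        using t_sq sq_sub below_sub_K EK unfolding D_def by blast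
    next
      fix b assume "b \<in> K"
      then obtain y where y: "y \<in> E" "b \<prec> y" "x \<prec> y" using above by blast
      then have "\<exists>c\<in>t y. b \<preceq> c" using sq_unbounded[OF t_sq] by blast
      then show "\<exists>c\<in>D. b \<preceq> c" using y unfolding D_def by blast
    next
      fix b assume "b \<in> K" and lp: "lp D b"
      then obtain y where y: "y \<in> E" "b \<prec> y" "x \<prec> y" using above by blast
      have "lp (t y) b"
        using lp D_below[OF y(1,3)] y(2) less_trans unfolding lp_def by (metis IntI mem_below)
      then have "b \<in> t y" using sq_closed[OF t_sq[OF y(1,3)] y(2)] by blast
      then show "b \<in> D" using y unfolding D_def by blast
    qed
    then obtain a where a: "a \<in> D" "lp D a" "D \<inter> below a \<notin> \<C> a"
      using sq_nontrivial by blast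
    then obtain y where y: "y \<in> E" "a \<prec> y" "x \<prec> y"
      using above clubD(1)[OF \<open>club D\<close>] by blast
    have "lp (t y) a"
      using a(2) D_below[OF y(1,3)] y(2) less_trans unfolding lp_def by (metis IntI mem_below)
    moreover have "a \<in> t y"
      using IntI[OF a(1) iffD2[OF mem_below y(2)]] unfolding D_below[OF y(1,3)] .
    ultimately have "t y \<inter> below a \<in> \<C> a"
      using sq_coherent[OF t_sq[OF y(1,3)]] by metis
    then show False
      using a(3) D_below[OF y(1,3)] cut[OF less_imp_le[OF y(2)], of D] by metis
  qed
  \<comment> \<open>As \<open>W x\<close> is small, one level \<open>y\<close> lies above the
    splittings of all its nodes.\<close>
  have "\<exists>y. y \<in> E \<and> x \<prec> y \<and> (\<forall>w\<in>W x. \<exists>w1\<in>W y. \<exists>w2\<in>W y. w1 \<noteq> w2 \<and> w1 \<inter> below x = w \<and> w2 \<inter> below x = w)"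
    if x: "x \<in> E" "e \<prec> x" for x
  proof -
    obtain n where n: "\<And>w. w \<in> W x \<Longrightarrow> n w \<in> E \<and> x \<prec> n w \<and>
      (\<exists>w1\<in>W (n w). \<exists>w2\<in>W (n w). w1 \<noteq> w2 \<and> w1 \<inter> below x = w \<and> w2 \<inter> below x = w)"
      using split[OF x] by metis
    have "n w \<in> K" if "w \<in> W x" for w using n[OF that] EK by metis
    then obtain b where b: "b \<in> K" "\<forall>w\<in>W x. n w \<prec> b"
      using bounded_image[OF ordLess_imp_ordLeq[OF W_card[OF x]], of n] by metis
    obtain y where y: "y \<in> E" "b \<prec> y" using clubD(2)[OF E b(1)] by blast
    obtain w0 where w0: "w0 \<in> W x" using W_nonempty[OF x] by blast
    have "x \<prec> n w0" using n[OF w0] by (elim conjE)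
    then have "x \<prec> y" using b(2)[rule_format, OF w0] y(2) by order
    then have "e \<prec> y" using x(2) by order
    have "\<exists>w1\<in>W y. \<exists>w2\<in>W y. w1 \<noteq> w2 \<and> w1 \<inter> below x = w \<and> w2 \<inter> below x = w" if w: "w \<in> W x" for w
    proof -
      obtain w1 w2 where w12: "w1 \<in> W (n w)" "w2 \<in> W (n w)" "w1 \<noteq> w2" "w1 \<inter> below x = w" "w2 \<inter> below x = w"
        using n[OF w] by blast
      have "x \<prec> n w" using n[OF w] by (elim conjE)
      then have "n w \<preceq> y" "x \<preceq> n w" using b(2)[rule_format, OF w] y(2) by order+
      then obtain w1' w2' where "w1' \<in> W y" "w1' \<inter> below (n w) = w1" "w2' \<in> W y" "w2' \<inter> below (n w) = w2"
        using W_ext[OF w12(1) _ y(1) \<open>e \<prec> y\<close>] W_ext[OF w12(2) _ y(1) \<open>e \<prec> y\<close>] by metis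
      then show ?thesis
        using w12 cut[OF \<open>x \<preceq> n w\<close>] by metis
    qed
    then show ?thesis using y(1) \<open>x \<prec> y\<close> by blast
  qed
  then obtain g0 where g0: "\<And>x. x \<in> E \<Longrightarrow> e \<prec> x \<Longrightarrow> g0 x \<in> E \<and> x \<prec> g0 x \<and>
      (\<forall>w\<in>W x. \<exists>w1\<in>W (g0 x). \<exists>w2\<in>W (g0 x). w1 \<noteq> w2 \<and> w1 \<inter> below x = w \<and> w2 \<inter> below x = w)"
    by metis
  \<comment> \<open>The value \<open>e\<close> at arguments \<open>\<preceq> e\<close> forces every
    nonzero closure point of \<open>g\<close> above \<open>e\<close>.\<close>
  define g where "g x = (if x \<in> E \<and> e \<prec> x then g0 x else if x \<preceq> e then e else x)" for x
  define D where "D = E \<inter> {d\<in>K. (\<exists>x. x \<prec> d) \<and> (\<forall>x. x \<prec> d \<longrightarrow> g x \<prec> d)}"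
  have D: "club D"
    unfolding D_def using g0 EK e(1) by (intro club_Int E club_closure) (auto simp: g_def)
  have De: "d \<in> E" "e \<prec> d" "x \<prec> d \<Longrightarrow> x \<in> E \<Longrightarrow> e \<prec> x \<Longrightarrow> g0 x \<prec> d" if "d \<in> D" for d x
  proof -
    show "d \<in> E" using that unfolding D_def by blast
    have cl: "\<exists>x. x \<prec> d" "\<And>x. x \<prec> d \<Longrightarrow> g x \<prec> d" using that unfolding D_def by blast+
    show "e \<prec> d"
    proof (rule ccontr)
      assume "\<not> e \<prec> d"
      then have "d \<preceq> e" using not_le by blast
      obtain x where "x \<prec> d" using cl(1) by blast
      then have "x \<preceq> e" using \<open>d \<preceq> e\<close> by (meson less_imp_le less_le_trans)
      then have "g x = e" unfolding g_def using leD by metis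
      then have "e \<prec> d" using cl(2)[OF \<open>x \<prec> d\<close>] by simp
      then show False using \<open>\<not> e \<prec> d\<close> by blast
    qed
    show "x \<prec> d \<Longrightarrow> x \<in> E \<Longrightarrow> e \<prec> x \<Longrightarrow> g0 x \<prec> d"
      using cl(2)[of x] by (simp add: g_def)
  qed
  have "\<not> |D| \<le>o l"
    using bounded[OF clubD(1)[OF D]] clubD(2)[OF D] less_trans by (metis less_irrefl)
  then have "|Field l| \<le>o |D|"
    using card_Field_l card_l by (meson card_of_Well_order card_order_on_well_order_on ordIso_ordLeq_trans ordLeq_total)
  then obtain j where j: "inj_on j (Field l)" "j ` Field l \<subseteq> D"
    using card_of_ordLeq[of "Field l" D] by blast
  \<comment> \<open>For each of \<open>l\<close> many \<open>x\<close> below \<open>d\<close>, a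
    node of \<open>W d\<close> will leave the fixed node \<open>w\<close> between \<open>x\<close>
    and \<open>g0 x\<close>. These intervals are disjoint, since points of \<open>D\<close> are
    closed under \<open>g0\<close>; so the nodes are distinct and too many for
    \<open>W d\<close>.\<close>
  define A where "A = j ` Field l"
  have A: "A \<subseteq> D" "|Field l| \<le>o |A|"
    using j card_of_ordLeq[of "Field l" A] unfolding A_def by blast+
  have "|A| \<le>o l"
    unfolding A_def by (intro image_le_l ordIso_imp_ordLeq card_Field_l)
  then obtain b where b: "b \<in> K" "\<And>d. d \<in> A \<Longrightarrow> d \<prec> b"
    using bounded[of A] subset_trans[OF A(1) clubD(1)[OF D]] by metis
  obtain d where d: "d \<in> D" "b \<prec> d" using clubD(2)[OF D b(1)] by blast
  have Ad: "x \<prec> d" if "x \<in> A" for x using b(2)[OF that] d(2) less_trans by blast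
  obtain w where w: "w \<in> W d" using W_nonempty De[OF d(1)] by blast
  have "\<exists>z\<in>W d. z \<inter> below x = w \<inter> below x \<and> z \<inter> below (g0 x) \<noteq> w \<inter> below (g0 x)" if x: "x \<in> A" for x
  proof -
    have xE: "x \<in> E" "e \<prec> x" using De x A(1) by blast+
    have g0d: "g0 x \<prec> d" "x \<preceq> g0 x" using De(3)[OF d(1) Ad[OF x] xE] g0[OF xE] less_imp_le by blast+
    obtain w1 where w1: "w1 \<in> W (g0 x)" "w1 \<noteq> w \<inter> below (g0 x)" "w1 \<inter> below x = w \<inter> below x"
      using g0[OF xE] W_down[OF w less_imp_le[OF Ad[OF x]]] by metis
    obtain z where z: "z \<in> W d" "z \<inter> below (g0 x) = w1"
      using W_ext[OF w1(1) less_imp_le[OF g0d(1)] De(1,2)[OF d(1)]] by blast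
    then show ?thesis
      using w1 cut[OF g0d(2), of z] by metis
  qed
  then obtain z where z: "\<And>x. x \<in> A \<Longrightarrow> z x \<in> W d \<and> z x \<inter> below x = w \<inter> below x \<and> z x \<inter> below (g0 x) \<noteq> w \<inter> below (g0 x)"
    by metis
  have ne: "z x \<noteq> z y" if "x \<in> A" "y \<in> A" "x \<prec> y" for x y
  proof -
    have "g0 x \<prec> y" using De(3)[of y x] De(1,2)[of x] that A(1) by blast
    then show ?thesis
      using z[OF that(1)] z[OF that(2)] cut[OF less_imp_le[OF \<open>g0 x \<prec> y\<close>]] by metis
  qed
  have "inj_on z A"
    using ne by (intro inj_onI) (metis less_linear)
  then have "|A| \<le>o |W d|"
    using card_of_ordLeq[of A "W d"] z by blast
  then have "l <o l"
    using A(2) W_card[OF De(1,2)[OF d(1)]] card_Field_l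
    by (meson ordIso_symmetric ordIso_ordLeq_trans ordLeq_ordLess_trans ordLeq_transitive)
  then show False
    using ordLess_irreflexive by blast
qed

end

subsection \<open>Guessing at gaps\<close>

context succ_card begin

text \<open>The disjoint sum contains both factors, and it is either finite with finite square or
  infinite and equinumerous with its square.\<close>

lemma Times_less_l:
  assumes "|A| <o l" "|B| <o l"
  shows "|A \<times> B| <o l"
proof -
  have lt: "|A <+> B| <o l"
    using card_of_Plus_ordLess_infinite_Field[of l A B] Cinfinite_l assms by (auto simp: cinfinite_def)
  have "A \<times> B \<subseteq> (\<lambda>(x, y). (projl x, projr y)) ` ((A <+> B) \<times> (A <+> B))"
    by (force simp: image_def)
  then have "|A \<times> B| \<le>o |(A <+> B) \<times> (A <+> B)|"
    using card_of_image card_of_mono1 ordLeq_transitive by metis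
  moreover have "|(A <+> B) \<times> (A <+> B)| <o l"
  proof (cases "finite (A <+> B)")
    case True
    then have "|(A <+> B) \<times> (A <+> B)| <o natLeq"
      using finite_iff_ordLess_natLeq by blast
    then show ?thesis
      using uncountable_l ordLess_transitive by blast
  next
    case False
    then show ?thesis
      using card_of_Times_same_infinite lt ordIso_ordLess_trans by blast
  qed
  ultimately show ?thesis
    using ordLeq_ordLess_trans by blast
qed

abbreviation idx :: "'a rel"
  where "idx \<equiv> l - Id"

lemma Well_order_l: "Well_order l"
  using card_l unfolding card_order_on_def by blast

lemma wf_idx: "wf idx"
  using Well_order_l unfolding well_order_on_def by blast

lemma idx_linear: "i \<in> Field l \<Longrightarrow> j \<in> Field l \<Longrightarrow> i \<noteq> j \<Longrightarrow> (i, j) \<in> idx \<or> (j, i) \<in> idx"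
  using Well_order_l unfolding order_on_defs total_on_def by auto

lemma idx_Field: "(i, j) \<in> idx \<Longrightarrow> i \<in> Field l \<and> j \<in> Field l"
  by (auto simp: Field_def)

lemma card_idx_below: "|{j. (j, i) \<in> idx}| <o l"
proof (cases "i \<in> Field l")
  case True
  have "{j. (j, i) \<in> idx} = underS l i" by (auto simp: underS_def)
  then show ?thesis using card_of_underS[OF card_l True] by simp
next
  case False
  then have "{j. (j, i) \<in> idx} = {}" by (auto simp: Field_def)
  then show ?thesis
    using finite_iff_ordLess_natLeq ordLess_transitive uncountable_l by (metis finite.emptyI)
qed

lemma card_idx_atMost: "|{j. (j, i) \<in> idx} \<union> {i}| <o l"
  using card_idx_below Cinfinite_l finite_iff_ordLess_natLeq[of "{i}"] ordLess_transitive uncountable_l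
  by (intro Un_Cinfinite_bound_strict) auto

lemma subset_less_l: "A \<subseteq> B \<Longrightarrow> |B| <o l \<Longrightarrow> |A| <o l"
  using card_of_mono1 ordLeq_ordLess_trans by blast

lemma empty_less_l: "|{} :: 'a set| <o l"
  using subset_less_l[OF empty_subsetI card_idx_below] .

text \<open>\<open>pigeonhole_l\<close>, having a fixed type as a locale assumption, takes its
  labels in \<open>Field l\<close>; fewer than \<open>l\<close> labels of any type inject into
  \<open>Field l\<close>.\<close>

lemma pigeonhole:
  assumes P: "|P| <o l" and p: "p ` Field l \<subseteq> P"
  shows "\<exists>y\<in>P. \<not> |{i\<in>Field l. p i = y}| <o l"
proof -
  have "|P| \<le>o |Field l|"
    using ordLess_imp_ordLeq[OF P] ordIso_symmetric[OF card_Field_l] by (rule ordLeq_ordIso_trans)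
  then obtain h where h: "inj_on h P" "h ` P \<subseteq> Field l"
    unfolding card_of_ordLeq[symmetric] by blast
  have "|h ` P| <o l"
    using card_of_image P by (rule ordLeq_ordLess_trans)
  moreover have "(h \<circ> p) ` Field l \<subseteq> h ` P" using p by auto
  ultimately obtain y where y: "\<not> |{i\<in>Field l. (h \<circ> p) i = y}| <o l"
    using pigeonhole_l[OF h(2)] by blast
  then have "{i\<in>Field l. (h \<circ> p) i = y} \<noteq> {}"
    using empty_less_l by metis
  then obtain i where i: "i \<in> Field l" "y = h (p i)" by auto
  have "{j\<in>Field l. (h \<circ> p) j = y} = {j\<in>Field l. p j = p i}"
    using h(1) p i by (auto dest: inj_onD)
  then show ?thesis
    using y p i(1) by auto
qed

text \<open>A bounded set of indices has size below \<open>l\<close>, because \<open>l\<close> is an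
  initial ordinal.\<close>

lemma ex_later:
  assumes I: "I \<subseteq> Field l" "\<not> |I| <o l" and i: "i \<in> Field l"
  shows "\<exists>j\<in>I. (i, j) \<in> idx"
proof (rule ccontr)
  assume "\<not> ?thesis"
  then have "I \<subseteq> {j. (j, i) \<in> idx} \<union> {i}"
    using idx_linear[OF i] I(1) by blast
  then show False
    using I(2) subset_less_l card_idx_atMost by blast
qed

end

section \<open>Guessing clubs, then functions, along gaps\<close>

context square_card
begin

text \<open>Monotonicity lets each witness \<open>e\<close> be moved up into a fixed cofinal set of
  size below \<open>l\<close>. As \<open>|\<C> a| <o l\<close> too, fewer than \<open>l\<close>
  pairs remain for \<open>l\<close> many indices.\<close>

lemma pigeonhole_sq:
  assumes a: "a \<in> S" and Q: "\<And>i. i \<in> Field l \<Longrightarrow> \<exists>C\<in>\<C> a. \<exists>e. e \<prec> a \<and> Q i C e"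
    and mono: "\<And>i C e e'. Q i C e \<Longrightarrow> e \<preceq> e' \<Longrightarrow> Q i C e'"
  shows "\<exists>C\<in>\<C> a. \<exists>e. e \<prec> a \<and> \<not> |{i\<in>Field l. Q i C e}| <o l"
proof -
  obtain A where A: "|A| <o l" "A \<subseteq> below a" "\<forall>b. b \<prec> a \<longrightarrow> (\<exists>c\<in>A. b \<preceq> c)"
    using S_cofinal[OF a] by blast
  have "\<exists>p\<in>\<C> a \<times> A. Q i (fst p) (snd p)" if i: "i \<in> Field l" for i
  proof -
    obtain C e where "C \<in> \<C> a" "e \<prec> a" "Q i C e" using Q[OF i] by blast
    moreover obtain c where "c \<in> A" "e \<preceq> c" using A(3) \<open>e \<prec> a\<close> by blast
    ultimately show ?thesis using mono[of i C e c] by force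
  qed
  then obtain p where p: "\<And>i. i \<in> Field l \<Longrightarrow> p i \<in> \<C> a \<times> A \<and> Q i (fst (p i)) (snd (p i))"
    by metis
  then have "p ` Field l \<subseteq> \<C> a \<times> A" by blast
  from pigeonhole[OF Times_less_l[OF S_card[OF a] A(1)] this]
  obtain y where y: "y \<in> \<C> a \<times> A" "\<not> |{i\<in>Field l. p i = y}| <o l"
    by blast
  have "{i\<in>Field l. p i = y} \<subseteq> {i\<in>Field l. Q i (fst y) (snd y)}"
    using p by blast
  then have "\<not> |{i\<in>Field l. Q i (fst y) (snd y)}| <o l"
    using y(2) subset_less_l by blast
  moreover have "fst y \<in> \<C> a" "snd y \<prec> a"
    using \<open>y \<in> \<C> a \<times> A\<close> A(2) mem_below by auto
  ultimately show ?thesis by blast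
qed

text \<open>Shelah's club guessing: shrinking a club \<open>l\<close> many times makes the decreasing values
  \<open>last_in (E i) v\<close> stabilise.\<close>
lemma club_guessing:
  "\<exists>E. club E \<and> (\<forall>D. club D \<longrightarrow> (\<exists>a\<in>S. \<forall>C\<in>\<C> a. \<forall>e. e \<prec> a \<longrightarrow>
    (\<exists>u v. consecutive C u v \<and> e \<prec> u \<and> (\<exists>x\<in>E. u \<prec> x \<and> x \<preceq> v) \<and> last_in E v \<in> D)))"
proof (rule ccontr)
  assume neg: "\<not> ?thesis"
  define Q where "Q E D C e \<longleftrightarrow> (\<forall>u v. consecutive C u v \<longrightarrow> e \<prec> u \<longrightarrow> (\<exists>x\<in>E. u \<prec> x \<and> x \<preceq> v) \<longrightarrow> last_in E v \<notin> D)"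
    for E D C e
  \<comment> \<open>Each club \<open>E\<close> has a club defeating it, which is intersected into
    all later clubs of the recursion.\<close>
  have "\<exists>D. club D \<and> (\<forall>a\<in>S. \<exists>C\<in>\<C> a. \<exists>e. e \<prec> a \<and> Q E D C e)" if "club E" for E
    using neg that unfolding Q_def by meson
  then obtain N where N: "\<And>E. club E \<Longrightarrow> club (N E)"
    "\<And>E a. club E \<Longrightarrow> a \<in> S \<Longrightarrow> \<exists>C\<in>\<C> a. \<exists>e. e \<prec> a \<and> Q E (N E) C e"
    by metis
  have "\<exists>E. \<forall>i. E i = K \<inter> (\<Inter>j\<in>{j. (j, i) \<in> idx}. E j \<inter> N (E j))"
    by (rule dependent_wf_choice[OF wf_idx]) auto
  then obtain E where E: "\<And>i. E i = K \<inter> (\<Inter>j\<in>{j. (j, i) \<in> idx}. E j \<inter> N (E j))" by blast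
  have clubE: "club (E i)" for i
  proof (induction i rule: wf_induct_rule[OF wf_idx])
    case (1 i)
    then have "club (K \<inter> (\<Inter>j\<in>{j. (j, i) \<in> idx}. E j \<inter> N (E j)))"
      using N(1) club_Int by (intro club_Inter ordLess_imp_ordLeq[OF card_idx_below]) blast
    then show ?case
      by (subst E)
  qed
  \<comment> \<open>Points of \<open>E'\<close> lie in every \<open>E i\<close>, so a gap met by
    \<open>E'\<close> is one to which the failures of all \<open>E i\<close> with
    \<open>i \<in> I\<close> apply.\<close>
  define E' where "E' = K \<inter> (\<Inter>i\<in>Field l. E i)"
  have "club E'"
    unfolding E'_def by (intro club_Inter clubE ordIso_imp_ordLeq card_Field_l)
  then obtain a where a: "a \<in> S"
    "\<And>C e. C \<in> \<C> a \<Longrightarrow> e \<prec> a \<Longrightarrow> \<exists>u v. consecutive C u v \<and> e \<prec> u \<and> (\<exists>x\<in>E'. u \<prec> x \<and> x \<preceq> v)"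
    using club_meets_gaps by blast
  have "\<exists>C\<in>\<C> a. \<exists>e. e \<prec> a \<and> \<not> |{i\<in>Field l. Q (E i) (N (E i)) C e}| <o l"
    using N(2)[OF clubE a(1)]
    by (rule pigeonhole_sq[OF a(1)]) (auto simp: Q_def dest: le_less_trans)
  then obtain C e where Ce: "C \<in> \<C> a" "e \<prec> a" "\<not> |{i\<in>Field l. Q (E i) (N (E i)) C e}| <o l" by blast
  define I where "I = {i\<in>Field l. Q (E i) (N (E i)) C e}"
  obtain u v x where uv: "consecutive C u v" "e \<prec> u" "x \<in> E'" "u \<prec> x" "x \<preceq> v"
    using a(2)[OF Ce(1,2)] by blast
  have "v \<in> K"
    using uv(1) sq_less[OF S_limit[OF a(1)] Ce(1)] down S_K[OF a(1)] unfolding consecutive_def by blast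
  have x: "x \<in> E i" if "i \<in> Field l" for i
    using uv(3) that unfolding E'_def by blast
  note last = last_in[OF clubE x uv(5) \<open>v \<in> K\<close>]
  \<comment> \<open>The last point of \<open>E i\<close> up to \<open>v\<close> avoids
    \<open>N (E i)\<close>, whereas later clubs are contained in \<open>N (E i)\<close>. Since
    \<open>I\<close> has no last index, the descent contradicts well-foundedness.\<close>
  have decr: "last_in (E j) v \<prec> last_in (E i) v" if "i \<in> I" "(i, j) \<in> idx" for i j
  proof -
    have ij: "i \<in> Field l" "j \<in> Field l" using idx_Field[OF that(2)] by auto
    have "last_in (E j) v \<in> E i \<inter> N (E i)"
      using last(1)[OF ij(2)] that(2) by (subst (asm) (2) E) blast
    moreover have "last_in (E i) v \<notin> N (E i)"
      using that(1) uv x[OF ij(1)] unfolding I_def Q_def by blast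
    ultimately show ?thesis
      using last(3)[OF ij(1), of "last_in (E j) v"] last(2)[OF ij(2)] by (metis IntE le_less)
  qed
  have I: "I \<subseteq> Field l" "\<not> |I| <o l" using Ce(3) unfolding I_def by auto
  then have "I \<noteq> {}" using empty_less_l by metis
  then obtain m where m: "m \<in> (\<lambda>i. last_in (E i) v) ` I" "\<And>z. z \<in> (\<lambda>i. last_in (E i) v) ` I \<Longrightarrow> m \<preceq> z"
    using ex_least[of "\<lambda>m. m \<in> (\<lambda>i. last_in (E i) v) ` I"] by blast
  then obtain i where i: "i \<in> I" "m = last_in (E i) v" by blast
  obtain j where "j \<in> I" "(i, j) \<in> idx" using ex_later[OF I] i(1) I(1) by blast
  then show False
    using decr[OF i(1)] m(2)[of "last_in (E j) v"] i(2) leD by blast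
qed

text \<open>The \<open>i\<close>-th attempt reads its guess off the first code below \<open>last_in E v\<close> that is correct
  about all targets which defeated the previous attempts. Since the code refuted at \<open>i\<close> is never
  used again, the least index of a fully correct code bounds the number of failures.\<close>
lemma guessing:
  fixes f :: "'b \<Rightarrow> 'a \<Rightarrow> 'v"
  assumes f: "\<And>g. (\<And>i. i \<in> Field l \<Longrightarrow> g i \<in> V) \<Longrightarrow> \<exists>b\<in>K. \<forall>i\<in>Field l. f b i = g i"
  shows "\<exists>\<Psi>. \<forall>F D. (\<forall>x\<in>K. F x \<in> V) \<longrightarrow> club D \<longrightarrow> (\<exists>a\<in>S. \<forall>C\<in>\<C> a. \<forall>e. e \<prec> a \<longrightarrow>
    (\<exists>u v. consecutive C u v \<and> e \<prec> u \<and> (\<exists>m\<in>D. u \<prec> m \<and> m \<preceq> v) \<and> \<Psi> u v = F u))"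
proof (rule ccontr)
  assume neg: "\<not> ?thesis"
  obtain E where E: "club E" "\<And>D. club D \<Longrightarrow> \<exists>a\<in>S. \<forall>C\<in>\<C> a. \<forall>e. e \<prec> a \<longrightarrow>
    (\<exists>u v. consecutive C u v \<and> e \<prec> u \<and> (\<exists>x\<in>E. u \<prec> x \<and> x \<preceq> v) \<and> last_in E v \<in> D)"
    using club_guessing by blast
  \<comment> \<open>Codes below \<open>m\<close> are compared through an injection into
    \<open>Field l\<close> rather than by \<open>\<prec>\<close>: this gives each of them fewer than
    \<open>l\<close> predecessors.\<close>
  have "\<exists>h. inj_on h (below m) \<and> h ` below m \<subseteq> Field l" if "m \<in> K" for m
    unfolding card_of_ordLeq
    using card_below[OF that] ordIso_symmetric[OF card_Field_l] by (rule ordLeq_ordIso_trans)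
  then obtain h where h0: "\<And>m. m \<in> K \<Longrightarrow> inj_on (h m) (below m) \<and> h m ` below m \<subseteq> Field l"
    by metis
  have h: "inj_on (h m) (below m)" "x \<prec> m \<Longrightarrow> h m x \<in> Field l" if "m \<in> K" for m x
    using h0[OF that] by auto
  define cand where "cand G i u m = {b. b \<prec> m \<and> (\<forall>j. (j, i) \<in> idx \<longrightarrow> f b j = G j u)}" for G :: "'a \<Rightarrow> 'b \<Rightarrow> 'v" and i u m
  define pick where "pick G i u m = (SOME b. b \<in> cand G i u m \<and> (\<forall>b'\<in>cand G i u m. (h m b', h m b) \<notin> idx))" for G i u m
  have pick: "pick G i u m \<in> cand G i u m" "b \<in> cand G i u m \<Longrightarrow> (h m b, h m (pick G i u m)) \<notin> idx"
    if "b0 \<in> cand G i u m" for b0 b G i u m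
  proof -
    have "\<exists>b. b \<in> cand G i u m \<and> (\<forall>b'\<in>cand G i u m. (h m b', h m b) \<notin> idx)"
      using wf_inv_image[OF wf_idx, of "h m"] that unfolding wf_eq_minimal in_inv_image by metis
    from someI_ex[OF this]
    show "pick G i u m \<in> cand G i u m" "b \<in> cand G i u m \<Longrightarrow> (h m b, h m (pick G i u m)) \<notin> idx"
      unfolding pick_def by blast+
  qed
  \<comment> \<open>Attempt \<open>i\<close> consults \<open>G\<close> only at indices before
    \<open>i\<close>, so the counterexamples \<open>G i\<close> can be chosen by recursion on
    \<open>i\<close>.\<close>
  define \<Psi> where "\<Psi> G i u v = f (pick G i u (last_in E v)) i" for G i u v
  define Q where "Q D F \<Phi> C e \<longleftrightarrow> (\<forall>u v. consecutive C u v \<longrightarrow> e \<prec> u \<longrightarrow> (\<exists>x\<in>E. u \<prec> x \<and> x \<preceq> v) \<longrightarrow>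
      last_in E v \<in> D \<longrightarrow> \<Phi> u v \<noteq> F u)" for D and F :: "'b \<Rightarrow> 'v" and \<Phi> C e
  define bad where "bad \<Phi> F D \<longleftrightarrow> (\<forall>x\<in>K. F x \<in> V) \<and> club D \<and> (\<forall>a\<in>S. \<exists>C\<in>\<C> a. \<exists>e. e \<prec> a \<and> Q D F \<Phi> C e)" for \<Phi> F D
  have "\<exists>F D. bad \<Phi> F D" for \<Phi>
  proof -
    obtain F D where FD: "\<forall>x\<in>K. F x \<in> V" "club D" "\<not> (\<exists>a\<in>S. \<forall>C\<in>\<C> a. \<forall>e. e \<prec> a \<longrightarrow>
    (\<exists>u v. consecutive C u v \<and> e \<prec> u \<and> (\<exists>m\<in>D. u \<prec> m \<and> m \<preceq> v) \<and> \<Phi> u v = F u))"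
      using neg by metis
    have "\<exists>C\<in>\<C> a. \<exists>e. e \<prec> a \<and> Q D F \<Phi> C e" if a: "a \<in> S" for a
    proof -
      obtain C e where Ce: "C \<in> \<C> a" "e \<prec> a"
        "\<not> (\<exists>u v. consecutive C u v \<and> e \<prec> u \<and> (\<exists>m\<in>D. u \<prec> m \<and> m \<preceq> v) \<and> \<Phi> u v = F u)"
        using FD(3) a by blast
      have "Q D F \<Phi> C e"
        unfolding Q_def
      proof (intro allI impI)
        fix u v assume uv: "consecutive C u v" "e \<prec> u" "\<exists>x\<in>E. u \<prec> x \<and> x \<preceq> v" "last_in E v \<in> D"
        then obtain x where x: "x \<in> E" "u \<prec> x" "x \<preceq> v" by blast
        have "v \<in> K"
          using uv(1) sq_less[OF S_limit[OF a] Ce(1)] down S_K[OF a] unfolding consecutive_def by blast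
        have "u \<prec> last_in E v" "last_in E v \<preceq> v"
          using last_in[OF E(1) x(1,3) \<open>v \<in> K\<close>] x less_le_trans by blast+
        then show "\<Phi> u v \<noteq> F u" using Ce(3) uv by blast
      qed
      then show ?thesis using Ce by blast
    qed
    then show ?thesis using FD unfolding bad_def by blast
  qed
  then have "\<exists>P. \<forall>i. bad (\<Psi> (\<lambda>j. fst (P j)) i) (fst (P i)) (snd (P i))"
    by (intro dependent_wf_choice[OF wf_idx]) (auto simp: \<Psi>_def pick_def cand_def)
  then obtain P where P: "\<And>i. bad (\<Psi> (\<lambda>j. fst (P j)) i) (fst (P i)) (snd (P i))" by blast
  define G D where "G i = fst (P i)" and "D i = snd (P i)" for i
  have GD: "bad (\<Psi> G i) (G i) (D i)" for i
    using P[of i] by (simp add: G_def[abs_def] D_def)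
  then have GV: "\<And>i x. x \<in> K \<Longrightarrow> G i x \<in> V" and D: "\<And>i. club (D i)"
    and bad: "\<And>i a. a \<in> S \<Longrightarrow> \<exists>C\<in>\<C> a. \<exists>e. e \<prec> a \<and> Q (D i) (G i) (\<Psi> G i) C e"
    unfolding bad_def by blast+
  have "\<exists>b\<in>K. \<forall>i\<in>Field l. f b i = G i x" if "x \<in> K" for x
    using f[of "\<lambda>i. G i x"] GV[OF that] by blast
  then obtain code where code: "\<And>x. x \<in> K \<Longrightarrow> code x \<in> K" "\<And>x i. x \<in> K \<Longrightarrow> i \<in> Field l \<Longrightarrow> f (code x) i = G i x"
    by metis
  \<comment> \<open>Closure of \<open>m\<close> under \<open>code\<close> puts the fully correct
    code of \<open>u\<close> among the candidates of every attempt.\<close>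
  define D' where "D' = {d\<in>K. (\<exists>x. x \<prec> d) \<and> (\<forall>x. x \<prec> d \<longrightarrow> code x \<prec> d)} \<inter> (K \<inter> (\<Inter>i\<in>Field l. D i))"
  have "club D'"
    unfolding D'_def by (intro club_Int club_closure code club_Inter D ordIso_imp_ordLeq card_Field_l)
  then obtain a where a: "a \<in> S" "\<And>C e. C \<in> \<C> a \<Longrightarrow> e \<prec> a \<Longrightarrow>
    \<exists>u v. consecutive C u v \<and> e \<prec> u \<and> (\<exists>x\<in>E. u \<prec> x \<and> x \<preceq> v) \<and> last_in E v \<in> D'"
    using E(2)[of D'] by blast
  have "\<exists>C\<in>\<C> a. \<exists>e. e \<prec> a \<and> \<not> |{i\<in>Field l. Q (D i) (G i) (\<Psi> G i) C e}| <o l"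
    using bad[OF a(1)]
    by (rule pigeonhole_sq[OF a(1)]) (unfold Q_def, meson le_less_trans)
  then obtain C e where Ce: "C \<in> \<C> a" "e \<prec> a" "\<not> |{i\<in>Field l. Q (D i) (G i) (\<Psi> G i) C e}| <o l" by blast
  define I where "I = {i\<in>Field l. Q (D i) (G i) (\<Psi> G i) C e}"
  have I: "I \<subseteq> Field l" "\<not> |I| <o l" using Ce(3) unfolding I_def by auto
  obtain u v x where uv: "consecutive C u v" "e \<prec> u" "x \<in> E" "u \<prec> x" "x \<preceq> v" "last_in E v \<in> D'"
    using a(2)[OF Ce(1,2)] by blast
  have "v \<in> K"
    using uv(1) sq_less[OF S_limit[OF a(1)] Ce(1)] down S_K[OF a(1)] unfolding consecutive_def by blast
  define m where "m = last_in E v"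
  have mK: "m \<in> K" and mD: "\<And>i. i \<in> Field l \<Longrightarrow> m \<in> D i" and cl: "\<And>x. x \<prec> m \<Longrightarrow> code x \<prec> m"
    using uv(6) unfolding D'_def m_def by blast+
  have "u \<prec> m"
    using last_in(3)[OF E(1) uv(3,5) \<open>v \<in> K\<close> uv(3,5)] uv(4) less_le_trans unfolding m_def by blast
  then have uK: "u \<in> K" using down[OF mK] by blast
  have fail: "f (pick G i u m) i \<noteq> G i u" if "i \<in> I" for i
    using that uv mD[of i] unfolding I_def Q_def \<Psi>_def m_def by blast
  have code_cand: "code u \<in> cand G i u m" for i
    using cl[OF \<open>u \<prec> m\<close>] code(2)[OF uK] idx_Field unfolding cand_def by blast
  have pk: "pick G i u m \<in> cand G i u m" "(h m (code u), h m (pick G i u m)) \<notin> idx" for i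
    using pick[OF code_cand] code_cand by blast+
  have pm: "pick G i u m \<prec> m" for i using pk(1)[of i] unfolding cand_def by blast
  \<comment> \<open>The later pick is correct at coordinate \<open>i\<close>, exactly where
    \<open>pick G i u m\<close> errs. The picks thus inject \<open>I\<close> into the segment of
    codes up to that of \<open>u\<close>.\<close>
  have ne: "pick G i u m \<noteq> pick G j u m" if "i \<in> I" "(i, j) \<in> idx" for i j
    using pk(1)[of j] fail[OF that(1)] that(2) unfolding cand_def by auto
  have "inj_on (\<lambda>i. pick G i u m) I"
    using ne idx_linear I(1) by (intro inj_onI) (metis subsetD)
  then have "inj_on (h m \<circ> (\<lambda>i. pick G i u m)) I"
    by (rule comp_inj_on) (rule inj_on_subset[OF h(1)[OF mK]], use pm in auto)
  moreover have "(h m \<circ> (\<lambda>i. pick G i u m)) ` I \<subseteq> {j. (j, h m (code u)) \<in> idx} \<union> {h m (code u)}"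
    using idx_linear[OF h(2)[OF mK pm] h(2)[OF mK cl[OF \<open>u \<prec> m\<close>]]] pk(2) by force
  ultimately have "|I| \<le>o |{j. (j, h m (code u)) \<in> idx} \<union> {h m (code u)}|"
    using card_of_ordLeq by blast
  then show False
    using I(2) card_idx_atMost ordLeq_ordLess_trans by blast
qed

end

subsection \<open>The levels of the tree\<close>

context succ_card begin

text \<open>The ladder of a branch that starts at level \<open>z\<close>, which need not belong to
  \<open>C\<close>.\<close>

definition tail :: "'b set \<Rightarrow> 'b \<Rightarrow> 'b set"
  where "tail C z = insert z {c\<in>C. z \<prec> c}"

definition all_nodes :: "('b \<times> 'b set) set"
  where "all_nodes = (SIGMA a:K. Pow (below a))"

lemma wf_less: "wf {(x, y). x \<prec> y}"
  unfolding wf_def using less_induct by auto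

lemma below_Int: "y \<preceq> x \<Longrightarrow> A \<inter> below x \<inter> below y = A \<inter> below y"
  using less_le_trans by auto

lemma below_Int_eq: "A \<inter> below x = B \<Longrightarrow> y \<preceq> x \<Longrightarrow> A \<inter> below y = B \<inter> below y"
  using below_Int by blast

lemma coherent_Union:
  assumes "\<And>w. w \<in> A \<Longrightarrow> y w \<subseteq> below w" and "\<And>w w'. w \<in> A \<Longrightarrow> w' \<in> A \<Longrightarrow> w' \<prec> w \<Longrightarrow> y w \<inter> below w' = y w'"
    and w: "w \<in> A"
  shows "(\<Union>w\<in>A. y w) \<inter> below w = y w"
proof
  show "(\<Union>w\<in>A. y w) \<inter> below w \<subseteq> y w"
  proof
    fix x assume "x \<in> (\<Union>w\<in>A. y w) \<inter> below w"
    then obtain w' where w': "w' \<in> A" "x \<in> y w'" "x \<prec> w" by auto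
    consider "w' \<prec> w" | "w' = w" | "w \<prec> w'" using less_linear by blast
    then show "x \<in> y w"
    proof cases
      case 1
      have "x \<in> y w \<inter> below w'" using w'(2) unfolding assms(2)[OF w w'(1) 1] .
      then show ?thesis by (rule IntD1)
    next
      case 2
      then show ?thesis using w'(2) by metis
    next
      case 3
      have "x \<in> y w' \<inter> below w" using w'(2,3) unfolding Int_iff mem_below by (rule conjI)
      then show ?thesis unfolding assms(2)[OF w'(1) w 3] .
    qed
  qed
  show "y w \<subseteq> (\<Union>w\<in>A. y w) \<inter> below w"
    using assms(1)[OF w] w by blast
qed

end

section \<open>Climbing along a ladder, and the recursion for the levels\<close>

context square_card
begin

text \<open>
  The nodes of level \<open>a\<close> are subsets of \<open>below a\<close>, standing for their characteristic functions. A node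
  is named by a pair of its level and the subset, and \<open>\<Psi> u v\<close> is a set of such pairs.
\<close>
definition hits :: "('b \<Rightarrow> 'b \<Rightarrow> ('b \<times> 'b set) set) \<Rightarrow> 'b \<Rightarrow> 'b \<Rightarrow> 'b set \<Rightarrow> bool"
  where "hits \<Psi> u v Y \<longleftrightarrow> (\<exists>(w, W)\<in>\<Psi> u v. w \<preceq> v \<and> Y \<inter> below w = W)"

text \<open>The choice depends on the gap and on \<open>y\<close> but not on the branch, which makes
  climbs unique. The implication keeps it meaningful when no extension hits the guess.\<close>

definition ext :: "('b \<Rightarrow> 'b \<Rightarrow> ('b \<times> 'b set) set) \<Rightarrow> 'b set set \<Rightarrow> 'b \<Rightarrow> 'b set \<Rightarrow> 'b \<Rightarrow> 'b set"
  where "ext \<Psi> L u y v = (SOME Y. Y \<in> L \<and> Y \<inter> below u = y \<and>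
    ((\<exists>Y'\<in>L. Y' \<inter> below u = y \<and> hits \<Psi> u v Y') \<longrightarrow> hits \<Psi> u v Y))"

text \<open>Only gaps are constrained: at an accumulation point of \<open>C\<close> the smaller
  initial segments of \<open>Y\<close> leave nothing to choose.\<close>

definition climbs :: "('b \<Rightarrow> 'b \<Rightarrow> ('b \<times> 'b set) set) \<Rightarrow> ('b \<Rightarrow> 'b set set) \<Rightarrow> 'b set \<Rightarrow> 'b \<Rightarrow> 'b set \<Rightarrow> 'b set \<Rightarrow> bool"
  where "climbs \<Psi> T C z X Y \<longleftrightarrow> Y \<inter> below z = X \<and>
    (\<forall>u v. consecutive (tail C z) u v \<longrightarrow> Y \<inter> below v = ext \<Psi> (T v) u (Y \<inter> below u) v)"

text \<open>
  The negative case covers zero, where it yields \<open>{{}}\<close>, and successors, where \<open>b\<close> is the predecessor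
  of \<open>a\<close>. The redundant \<open>C \<subseteq> below a\<close> makes the recursion well-founded for every \<open>\<C>\<close>.
\<close>
definition next_level :: "('b \<Rightarrow> 'b \<Rightarrow> ('b \<times> 'b set) set) \<Rightarrow> ('b \<Rightarrow> 'b set set) \<Rightarrow> 'b \<Rightarrow> 'b set set"
  where "next_level \<Psi> T a = {Y. Y \<subseteq> below a \<and>
    (if limit a then \<exists>C\<in>\<C> a. C \<subseteq> below a \<and> (\<exists>z. z \<prec> a \<and> (\<exists>X\<in>T z. climbs \<Psi> T C z X Y))
     else \<forall>b. b \<prec> a \<and> (\<forall>x. x \<prec> a \<longrightarrow> x \<preceq> b) \<longrightarrow> Y \<inter> below b \<in> T b)}"

lemma next_level_cong:
  assumes "\<And>x. x \<prec> a \<Longrightarrow> T x = T' x"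
  shows "next_level \<Psi> T a = next_level \<Psi> T' a"
proof -
  have "climbs \<Psi> T C z X Y \<longleftrightarrow> climbs \<Psi> T' C z X Y" if "C \<subseteq> below a" "z \<prec> a" for C z X Y
  proof -
    have "T v = T' v" if "consecutive (tail C z) u v" for u v
    proof -
      have "v \<in> insert z C" using that unfolding consecutive_def tail_def by blast
      then show ?thesis using assms \<open>C \<subseteq> below a\<close> \<open>z \<prec> a\<close> by (metis insertE mem_below subsetD)
    qed
    then show ?thesis unfolding climbs_def by metis
  qed
  then show ?thesis
    unfolding next_level_def using assms by (intro Collect_cong conj_cong refl if_cong) (metis, metis)
qed

lemma ex_levels: "\<exists>T. \<forall>a. T a = next_level \<Psi> T a"
proof (rule dependent_wf_choice[OF wf_less], goal_cases)
  case (1 f g a r)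
  then have "next_level \<Psi> f a = next_level \<Psi> g a" by (intro next_level_cong) simp
  then show ?case by simp
qed blast

lemma tail_pred:
  assumes a: "limit a" and C: "C \<in> \<C> a" and v: "v \<in> C" "z \<prec> v" "\<not> lp C v"
  shows "\<exists>u. consecutive (tail C z) u v"
proof -
  have va: "v \<prec> a" using sq_less[OF a C v(1)] .
  have "\<exists>m. m \<in> tail C z \<inter> below v \<and> m \<preceq> v \<and> (\<forall>y\<in>tail C z \<inter> below v. y \<preceq> v \<longrightarrow> y \<preceq> m)"
  proof (rule ex_last)
    fix b assume b: "b \<preceq> v" and lp: "lp (tail C z \<inter> below v) b"
    have lpC: "\<exists>y\<in>C. x \<prec> y \<and> y \<prec> b \<and> z \<prec> y" if x: "x \<prec> b" for x
    proof -
      \<comment> \<open>Two steps are taken because the first may end in \<open>z\<close>, which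
        need not be in \<open>C\<close>.\<close>
      obtain y where y: "y \<in> tail C z" "x \<prec> y" "y \<prec> b" using lpD[OF lp x] by blast
      obtain y' where y': "y' \<in> tail C z" "y \<prec> y'" "y' \<prec> b" using lpD[OF lp y(3)] by blast
      have "z \<preceq> y" using y(1) less_imp_le unfolding tail_def by blast
      then have "z \<prec> y'" "x \<prec> y'" using y'(2) y(2) by order+
      then show ?thesis using y' unfolding tail_def by blast
    qed
    have "lp C b" using lpC lp_nonzero[OF lp] unfolding lp_def by blast
    have "b \<prec> a" using b va by order
    then have "b \<in> C" using sq_closed[OF a C] \<open>lp C b\<close> by metis
    moreover have "b \<prec> v" using b v(3) \<open>lp C b\<close> le_less by metis
    moreover have "z \<prec> b" using lpC lp_nonzero[OF lp] less_trans by metis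
    ultimately show "b \<in> tail C z \<inter> below v" unfolding tail_def by simp
  next
    show "z \<in> tail C z \<inter> below v" "z \<preceq> v"
      using v(2) less_imp_le unfolding tail_def by auto
  qed
  then obtain u where u: "u \<in> tail C z" "u \<prec> v" "\<And>y. y \<in> tail C z \<Longrightarrow> y \<prec> v \<Longrightarrow> y \<preceq> u"
    using less_imp_le by auto
  have "v \<in> tail C z" using v unfolding tail_def by simp
  then have "consecutive (tail C z) u v"
    unfolding consecutive_def using u by (metis leD not_le)
  then show ?thesis by blast
qed

lemma consecutive_tail_Int:
  assumes "z \<prec> v" "consecutive (tail (C \<inter> below v) z) u w"
  shows "consecutive (tail C z) u w" "w \<prec> v"
proof -
  have uw: "u \<in> tail (C \<inter> below v) z" "w \<in> tail (C \<inter> below v) z" "u \<prec> w"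
    "\<And>x. x \<in> tail (C \<inter> below v) z \<Longrightarrow> u \<prec> x \<Longrightarrow> w \<preceq> x"
    using assms(2) unfolding consecutive_def by blast+
  show "w \<prec> v" using uw(2) assms(1) unfolding tail_def by auto
  have "w \<preceq> x" if "x \<in> tail C z" "u \<prec> x" for x
  proof (cases "x \<prec> v")
    case True
    then have "x \<in> tail (C \<inter> below v) z" using that(1) unfolding tail_def by auto
    then show ?thesis using uw(4) that(2) by blast
  next
    case False
    then show ?thesis using \<open>w \<prec> v\<close> by order
  qed
  moreover have "tail (C \<inter> below v) z \<subseteq> tail C z" unfolding tail_def by blast
  ultimately show "consecutive (tail C z) u w"
    unfolding consecutive_def using uw by blast
qed

lemma consecutive_tail:
  assumes "consecutive C u v" "z \<prec> u"
  shows "consecutive (tail C z) u v"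
  using assms unfolding consecutive_def tail_def by (auto dest: less_trans leD)

end

section \<open>Extension, restriction and size of the levels\<close>

locale tree_levels = square_card less_eq less K l \<C> S
  for less_eq :: "'b \<Rightarrow> 'b \<Rightarrow> bool" (infix "\<preceq>" 50) and less :: "'b \<Rightarrow> 'b \<Rightarrow> bool" (infix "\<prec>" 50)
    and K :: "'b set" and l :: "'a rel" and \<C> :: "'b \<Rightarrow> 'b set set" and S :: "'b set" +
  fixes \<Psi> :: "'b \<Rightarrow> 'b \<Rightarrow> ('b \<times> 'b set) set" and T :: "'b \<Rightarrow> 'b set set"
  assumes T_rec: "T a = next_level \<Psi> T a"
begin

lemma T_below: "Y \<in> T a \<Longrightarrow> Y \<subseteq> below a"
  using T_rec[of a] unfolding next_level_def by blast

lemma T_self: "Y \<in> T a \<Longrightarrow> Y \<inter> below a = Y"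
  using T_below by blast

lemma not_limit: "b \<prec> a \<Longrightarrow> (\<And>x. x \<prec> a \<Longrightarrow> x \<preceq> b) \<Longrightarrow> \<not> limit a"
  using limitD(2) leD by blast

lemma T_zero: "(\<And>x. \<not> x \<prec> a) \<Longrightarrow> T a = {{}}"
  using T_rec[of a] limitD(3)[of a] unfolding next_level_def below_def by auto

lemma T_suc:
  assumes b: "b \<prec> a" "\<And>x. x \<prec> a \<Longrightarrow> x \<preceq> b"
  shows "Y \<in> T a \<longleftrightarrow> Y \<subseteq> below a \<and> Y \<inter> below b \<in> T b"
proof -
  have "b' = b" if "b' \<prec> a" "\<forall>x. x \<prec> a \<longrightarrow> x \<preceq> b'" for b'
    using that(2)[rule_format, OF b(1)] b(2)[OF that(1)] by order
  then have "(\<forall>b. b \<prec> a \<and> (\<forall>x. x \<prec> a \<longrightarrow> x \<preceq> b) \<longrightarrow> Y \<inter> below b \<in> T b) \<longleftrightarrow> Y \<inter> below b \<in> T b"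
    using b by metis
  then show ?thesis
    using not_limit[OF b] by (subst T_rec) (simp add: next_level_def)
qed

lemma T_limit:
  assumes "limit a"
  shows "Y \<in> T a \<longleftrightarrow> Y \<subseteq> below a \<and> (\<exists>C\<in>\<C> a. \<exists>z X. z \<prec> a \<and> X \<in> T z \<and> climbs \<Psi> T C z X Y)"
  using assms sq_sub[OF assms] by (subst T_rec) (auto simp: next_level_def)

text \<open>At an accumulation point \<open>v\<close> of \<open>C\<close>, coherence puts
  \<open>C \<inter> below v\<close> in \<open>\<C> v\<close>, so an initial segment of a climb
  becomes a node of level \<open>v\<close>. Only gaps below \<open>v\<close> are assumed, which
  covers climbs still under construction.\<close>

lemma climbs_Int:
  assumes v: "z \<prec> v" and Y: "Y \<inter> below z = X"
    "\<And>u w. consecutive (tail C z) u w \<Longrightarrow> w \<prec> v \<Longrightarrow> Y \<inter> below w = ext \<Psi> (T w) u (Y \<inter> below u) w"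
  shows "climbs \<Psi> T (C \<inter> below v) z X (Y \<inter> below v)"
  unfolding climbs_def
proof (intro conjI allI impI)
  show "Y \<inter> below v \<inter> below z = X"
    using below_Int[OF less_imp_le[OF v]] Y(1) by simp
  fix u w assume uw: "consecutive (tail (C \<inter> below v) z) u w"
  note c = consecutive_tail_Int[OF v uw]
  have "u \<prec> w" using uw unfolding consecutive_def by blast
  then have "u \<preceq> v" "w \<preceq> v" using c(2) by order+
  then show "Y \<inter> below v \<inter> below w = ext \<Psi> (T w) u (Y \<inter> below v \<inter> below u) w"
    using Y(2)[OF c] by (simp only: below_Int)
qed

lemma ext_props:
  assumes "\<exists>Y\<in>T v. Y \<inter> below u = y"
  shows "ext \<Psi> (T v) u y v \<in> T v" "ext \<Psi> (T v) u y v \<inter> below u = y"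
    "Y' \<in> T v \<Longrightarrow> Y' \<inter> below u = y \<Longrightarrow> hits \<Psi> u v Y' \<Longrightarrow> hits \<Psi> u v (ext \<Psi> (T v) u y v)"
proof -
  have "\<exists>Y. Y \<in> T v \<and> Y \<inter> below u = y \<and> ((\<exists>Y'\<in>T v. Y' \<inter> below u = y \<and> hits \<Psi> u v Y') \<longrightarrow> hits \<Psi> u v Y)"
    using assms by blast
  from someI_ex[OF this]
  show "ext \<Psi> (T v) u y v \<in> T v" "ext \<Psi> (T v) u y v \<inter> below u = y"
    "Y' \<in> T v \<Longrightarrow> Y' \<inter> below u = y \<Longrightarrow> hits \<Psi> u v Y' \<Longrightarrow> hits \<Psi> u v (ext \<Psi> (T v) u y v)"
    unfolding ext_def by blast+
qed

definition extendable :: "'b \<Rightarrow> bool"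
  where "extendable a \<longleftrightarrow> (\<forall>b X. b \<preceq> a \<longrightarrow> X \<in> T b \<longrightarrow> (\<exists>Y\<in>T a. Y \<inter> below b = X))"

text \<open>At accumulation points of \<open>C\<close> this is coherence. At the other points the
  initial segment is a value of \<open>ext\<close>, which is a node because lower levels are
  extendable.\<close>

lemma climbs_level:
  assumes a: "limit a" and C: "C \<in> \<C> a" and z: "z \<prec> a" "X \<in> T z" and Y: "climbs \<Psi> T C z X Y"
    and extendable: "\<And>v. v \<prec> a \<Longrightarrow> extendable v"
    and v: "v \<in> C" "z \<prec> v"
  shows "Y \<inter> below v \<in> T v"
  using v
proof (induction v rule: less_induct)
  case (less v)
  show ?case
  proof (cases "lp C v")
    case True
    have va: "v \<prec> a" using sq_less[OF a C less(2)] .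
    have "C \<subseteq> K" using sq_sub[OF a C] below_sub_K[OF limitD(1)[OF a]] by blast
    then have "limit v" using lp_limit[OF True] down[OF limitD(1)[OF a] va] by blast
    moreover have "C \<inter> below v \<in> \<C> v" using sq_coherent[OF a C less(2) True] .
    moreover have "climbs \<Psi> T (C \<inter> below v) z X (Y \<inter> below v)"
      using Y by (intro climbs_Int less(3)) (auto simp: climbs_def)
    ultimately show ?thesis
      using T_limit[of v "Y \<inter> below v"] less(3) z(2) by blast
  next
    case False
    obtain u where u: "consecutive (tail C z) u v"
      using tail_pred[OF a C less(2,3) False] by blast
    then have "u \<prec> v" "u \<in> tail C z" unfolding consecutive_def by blast+
    have "Y \<inter> below u \<in> T u"
    proof (cases "u = z")
      case True
      then show ?thesis using Y z(2) unfolding climbs_def by simp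
    next
      case False
      then have "u \<in> C" "z \<prec> u" using \<open>u \<in> tail C z\<close> unfolding tail_def by auto
      then show ?thesis using less(1)[OF \<open>u \<prec> v\<close>] by metis
    qed
    then have "\<exists>Y'\<in>T v. Y' \<inter> below u = Y \<inter> below u"
      using extendable[OF sq_less[OF a C less(2)]] less_imp_le[OF \<open>u \<prec> v\<close>] unfolding extendable_def by blast
    then show ?thesis
      using ext_props(1) u Y unfolding climbs_def by metis
  qed
qed

text \<open>The danger is a limit stage at which the union of the climb so far is no node. At
  accumulation points of \<open>C\<close> coherence excludes this, since the union climbs along a
  member of \<open>\<C> v\<close>.\<close>

lemma ex_climbs:
  assumes a: "limit a" and C: "C \<in> \<C> a" and z: "z \<prec> a" "X \<in> T z"
    and extendable: "\<And>v. v \<prec> a \<Longrightarrow> extendable v"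
  shows "\<exists>Y\<subseteq>below a. climbs \<Psi> T C z X Y"
proof -
  let ?U = "\<lambda>v. {w \<in> tail C z. w \<prec> v}"
  \<comment> \<open>The recursion runs over all ordinals; its values off \<open>tail C z\<close> are
    never consulted.\<close>
  have "\<exists>y. \<forall>v. y v = (if v = z then X
      else if \<exists>u. consecutive (tail C z) u v
      then ext \<Psi> (T v) (SOME u. consecutive (tail C z) u v) (y (SOME u. consecutive (tail C z) u v)) v
      else (\<Union>w\<in>?U v. y w))"
  proof (rule dependent_wf_choice[OF wf_less], goal_cases)
    case (1 f g v r)
    have "(SOME u. consecutive (tail C z) u v) \<prec> v" if "\<exists>u. consecutive (tail C z) u v"
      using someI_ex[OF that] unfolding consecutive_def by blast
    then have "f (SOME u. consecutive (tail C z) u v) = g (SOME u. consecutive (tail C z) u v)"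
      if "\<exists>u. consecutive (tail C z) u v" using 1 that by blast
    moreover have "(\<Union>w\<in>?U v. f w) = (\<Union>w\<in>?U v. g w)" using 1 by (intro SUP_cong) auto
    ultimately show ?case by (auto split: if_split)
  qed auto
  then obtain y where y: "\<And>v. y v = (if v = z then X
      else if \<exists>u. consecutive (tail C z) u v
      then ext \<Psi> (T v) (SOME u. consecutive (tail C z) u v) (y (SOME u. consecutive (tail C z) u v)) v
      else (\<Union>w\<in>?U v. y w))" by blast
  have tail_ge: "z \<preceq> v" if "v \<in> tail C z" for v
    using that less_imp_le unfolding tail_def by auto
  have tail_a: "v \<prec> a" if "v \<in> tail C z" for v
    using that z(1) sq_less[OF a C] unfolding tail_def by auto
  have pred_uniq: "u = u'" if "consecutive (tail C z) u v" "consecutive (tail C z) u' v" for u u' v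
    using that unfolding consecutive_def by (meson leD less_linear)
  have y_z: "y z = X" by (subst y) simp
  have y_cons: "y v = ext \<Psi> (T v) u (y u) v" if uv: "consecutive (tail C z) u v" for u v
  proof -
    have "v \<noteq> z" using uv tail_ge[of u] leD unfolding consecutive_def by blast
    moreover have "(SOME u. consecutive (tail C z) u v) = u"
      using uv pred_uniq by blast
    ultimately show ?thesis using uv by (subst y) auto
  qed
  have main: "y v \<in> T v \<and> (\<forall>w. w \<in> tail C z \<longrightarrow> w \<prec> v \<longrightarrow> y v \<inter> below w = y w)" if "v \<in> tail C z" for v
    using that
  proof (induction v rule: less_induct)
    case (less v)
    consider "v = z" | u where "consecutive (tail C z) u v" | "v \<noteq> z" "\<nexists>u. consecutive (tail C z) u v" by blast
    then show ?case
    proof cases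
      case 1
      then show ?thesis using y_z z(2) tail_ge leD by metis
    next
      case (2 u)
      then have u: "u \<prec> v" "u \<in> tail C z" "\<And>w. w \<in> tail C z \<Longrightarrow> w \<prec> v \<Longrightarrow> w \<preceq> u"
        unfolding consecutive_def using leD not_le by blast+
      note IH = less(1)[OF u(1,2)]
      have "\<exists>Y\<in>T v. Y \<inter> below u = y u"
        using extendable[OF tail_a[OF less(2)]] IH less_imp_le[OF u(1)] unfolding extendable_def by blast
      note ext = ext_props(1,2)[OF this, folded y_cons[OF 2]]
      have "y v \<inter> below w = y w" if w: "w \<in> tail C z" "w \<prec> v" for w
      proof -
        have "w \<preceq> u" using u(3)[OF w] .
        then have "y v \<inter> below w = y u \<inter> below w" by (rule below_Int_eq[OF ext(2)])
        also have "\<dots> = y w"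
          using IH w(1) \<open>w \<preceq> u\<close> T_self le_less by metis
        finally show ?thesis .
      qed
      then show ?thesis using ext(1) by blast
    next
      case 3
      then have v: "v \<in> C" "z \<prec> v" using less(2) unfolding tail_def by auto
      have lp: "lp C v" using tail_pred[OF a C v] 3(2) by blast
      have va: "v \<prec> a" using tail_a[OF less(2)] .
      have "C \<subseteq> K" using sq_sub[OF a C] below_sub_K[OF limitD(1)[OF a]] by blast
      then have "limit v" using lp_limit[OF lp] down[OF limitD(1)[OF a] va] by blast
      have yv: "y v = (\<Union>w\<in>?U v. y w)" using 3 by (subst y) simp
      have coh: "y v \<inter> below w = y w" if "w \<in> tail C z" "w \<prec> v" for w
        unfolding yv
      proof (rule coherent_Union)
        fix w assume "w \<in> ?U v" then show "y w \<subseteq> below w" using less(1) T_below by blast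
      qed (use less(1) that in auto)
      have "y v \<subseteq> below v"
      proof
        fix x assume "x \<in> y v"
        then obtain w where "w \<in> tail C z" "w \<prec> v" "x \<in> y w" unfolding yv by blast
        then have "x \<prec> w" using less(1)[of w] T_below mem_below by blast
        then show "x \<in> below v" using \<open>w \<prec> v\<close> by simp
      qed
      then have self: "y v \<inter> below v = y v" by blast
      have "climbs \<Psi> T (C \<inter> below v) z X (y v \<inter> below v)"
      proof (rule climbs_Int[OF v(2)])
        show "y v \<inter> below z = X" using coh[of z] v(2) y_z unfolding tail_def by simp
      next
        fix u w assume uw: "consecutive (tail C z) u w" "w \<prec> v"
        then have "u \<in> tail C z" "w \<in> tail C z" "u \<prec> v"
          unfolding consecutive_def using less_trans by blast+
        then show "y v \<inter> below w = ext \<Psi> (T w) u (y v \<inter> below u) w"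
          using y_cons[OF uw(1)] coh uw(2) by metis
      qed
      then have "y v \<in> T v"
        using T_limit[OF \<open>limit v\<close>, of "y v"] sq_coherent[OF a C v(1) lp] \<open>y v \<subseteq> below v\<close> v(2) z(2)
        unfolding self by blast
      then show ?thesis using coh by blast
    qed
  qed
  define Y where "Y = (\<Union>w\<in>tail C z. y w)"
  have Y: "Y \<inter> below w = y w" if "w \<in> tail C z" for w
    unfolding Y_def by (rule coherent_Union[OF _ _ that]) (use main T_below in blast)+
  have "Y \<subseteq> below a"
  proof
    fix x assume "x \<in> Y"
    then obtain w where "w \<in> tail C z" "x \<in> y w" unfolding Y_def by blast
    then have "x \<prec> w" "w \<prec> a" using main[of w] T_below mem_below tail_a by blast+
    then show "x \<in> below a" by simp
  qed
  moreover have "climbs \<Psi> T C z X Y"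
    unfolding climbs_def
  proof (intro conjI allI impI)
    show "Y \<inter> below z = X" using Y[of z] y_z unfolding tail_def by simp
    fix u v assume uv: "consecutive (tail C z) u v"
    then have "u \<in> tail C z" "v \<in> tail C z" unfolding consecutive_def by blast+
    then show "Y \<inter> below v = ext \<Psi> (T v) u (Y \<inter> below u) v"
      using Y y_cons[OF uv] by metis
  qed
  ultimately show ?thesis by blast
qed

lemma extendable: "a \<in> K \<Longrightarrow> extendable a"
proof (induction a rule: less_induct)
  case (less a)
  then have IH: "extendable v" if "v \<prec> a" for v using down that by blast
  show ?case
    unfolding extendable_def
  proof (intro allI impI)
    fix b X assume b: "b \<preceq> a" and X: "X \<in> T b"
    show "\<exists>Y\<in>T a. Y \<inter> below b = X"
    proof (cases "b = a")
      case True
      then show ?thesis using X T_self by blast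
    next
      case False
      then have ba: "b \<prec> a" using b by order
      from less(2) show ?thesis
      proof (cases rule: zero_suc_limit)
        case zero
        then show ?thesis using ba by blast
      next
        case (suc c)
        then obtain Y where Y: "Y \<in> T c" "Y \<inter> below b = X"
          using IH[OF suc(1)] X ba unfolding extendable_def by blast
        then have "Y \<subseteq> below a" using T_below[OF Y(1)] suc(1) by (auto dest: less_trans)
        then have "Y \<in> T a" using T_suc[OF suc] Y(1) T_self by simp
        then show ?thesis using Y by blast
      next
        case limit
        obtain C where C: "C \<in> \<C> a" using sq_nonempty[OF limit] by blast
        obtain Y where Y: "Y \<subseteq> below a" "climbs \<Psi> T C b X Y"
          using ex_climbs[OF limit C ba X IH] by blast
        then have "Y \<in> T a" using T_limit[OF limit] C ba X by blast
        then show ?thesis using Y unfolding climbs_def by blast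
      qed
    qed
  qed
qed

lemma T_extend: "a \<in> K \<Longrightarrow> b \<preceq> a \<Longrightarrow> X \<in> T b \<Longrightarrow> \<exists>Y\<in>T a. Y \<inter> below b = X"
  using extendable unfolding extendable_def by blast

lemma T_climbs:
  assumes "limit a" "C \<in> \<C> a" "z \<prec> a" "X \<in> T z" "climbs \<Psi> T C z X Y" "v \<in> C" "z \<prec> v"
  shows "Y \<inter> below v \<in> T v"
  using climbs_level[OF assms(1-5) _ assms(6,7)] extendable down[OF limitD(1)[OF assms(1)]] by blast

text \<open>At a limit, some point \<open>v\<close> of the ladder lies above both \<open>b\<close>
  and the starting point; there the branch is already a node of a lower level, and induction
  applies.\<close>

lemma T_restrict: "a \<in> K \<Longrightarrow> Y \<in> T a \<Longrightarrow> b \<preceq> a \<Longrightarrow> Y \<inter> below b \<in> T b"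
proof (induction a arbitrary: b Y rule: less_induct)
  case (less a)
  show ?case
  proof (cases "b = a")
    case True
    then show ?thesis using less(3) T_self by simp
  next
    case False
    then have ba: "b \<prec> a" using less(4) by order
    from less(2) show ?thesis
    proof (cases rule: zero_suc_limit)
      case zero
      then show ?thesis using ba by blast
    next
      case (suc c)
      have "Y \<inter> below c \<in> T c" using T_suc[OF suc] less(3) by blast
      then have "Y \<inter> below c \<inter> below b \<in> T b"
        using less(1)[OF suc(1) down[OF less(2) suc(1)]] suc(2)[OF ba] by blast
      then show ?thesis using below_Int[OF suc(2)[OF ba]] by simp
    next
      case limit
      then obtain C z X where C: "C \<in> \<C> a" "z \<prec> a" "X \<in> T z" "climbs \<Psi> T C z X Y"
        using T_limit less(3) by blast
      obtain c where "c \<in> C" "z \<prec> c" using sq_unbounded_strict[OF limit C(1,2)] by blast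
      obtain c' where "c' \<in> C" "b \<prec> c'" using sq_unbounded_strict[OF limit C(1) ba] by blast
      obtain v where v: "v \<in> C" "z \<prec> v" "b \<prec> v"
        using \<open>c \<in> C\<close> \<open>z \<prec> c\<close> \<open>c' \<in> C\<close> \<open>b \<prec> c'\<close> by (meson le_less_trans less_le_trans linear not_le)
      have "v \<prec> a" using sq_less[OF limit C(1) v(1)] .
      then have "Y \<inter> below v \<inter> below b \<in> T b"
        using less(1)[of v] T_climbs[OF limit C v(1,2)] down[OF less(2)] less_imp_le[OF v(3)] by blast
      then show ?thesis using below_Int[OF less_imp_le[OF v(3)]] by simp
    qed
  qed
qed

text \<open>A consequence of \<open>ext\<close> being a function. It bounds a limit level by the
  number of triples \<open>(C, z, X)\<close>, hence by \<open>l\<close>.\<close>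

lemma climbs_unique:
  assumes a: "limit a" and C: "C \<in> \<C> a" and z: "z \<prec> a"
    and Y: "Y \<subseteq> below a" "climbs \<Psi> T C z X Y" and Y': "Y' \<subseteq> below a" "climbs \<Psi> T C z X Y'"
  shows "Y = Y'"
proof -
  have eq: "Y \<inter> below v = Y' \<inter> below v" if "v \<in> C" "z \<prec> v" for v
    using that
  proof (induction v rule: less_induct)
    case (less v)
    show ?case
    proof (cases "lp C v")
      case True
      have "\<exists>w. w \<in> C \<and> z \<prec> w \<and> w \<prec> v \<and> x \<prec> w" if "x \<prec> v" for x
      proof (cases "x \<preceq> z")
        case True
        then show ?thesis using lpD[OF \<open>lp C v\<close> less(3)] le_less_trans by metis
      next
        case False
        then have "z \<prec> x" by order
        then show ?thesis using lpD[OF \<open>lp C v\<close> that] less_trans by metis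
      qed
      then have "x \<in> Y \<longleftrightarrow> x \<in> Y'" if "x \<prec> v" for x
        using less(1) that by (metis IntE IntI mem_below)
      then show ?thesis by auto
    next
      case False
      obtain u where u: "consecutive (tail C z) u v"
        using tail_pred[OF a C less(2,3) False] by blast
      then have "u \<prec> v" "u = z \<or> u \<in> C \<and> z \<prec> u" unfolding consecutive_def tail_def by blast+
      then have "Y \<inter> below u = Y' \<inter> below u"
        using less(1) Y(2) Y'(2) unfolding climbs_def by metis
      then show ?thesis using u Y(2) Y'(2) unfolding climbs_def by metis
    qed
  qed
  have "x \<in> Y \<longleftrightarrow> x \<in> Y'" if x: "x \<prec> a" for x
  proof -
    obtain c where c: "c \<in> C" "z \<prec> c" using sq_unbounded_strict[OF a C z] by blast
    obtain c' where c': "c' \<in> C" "x \<prec> c'" using sq_unbounded_strict[OF a C x] by blast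
    show ?thesis
    proof (cases "c \<preceq> c'")
      case True
      then have "z \<prec> c'" using c by order
      then show ?thesis using eq[OF c'(1)] c'(2) by (metis IntE IntI mem_below)
    next
      case False
      then have "x \<prec> c" using c' by order
      then show ?thesis using eq[OF c] by (metis IntE IntI mem_below)
    qed
  qed
  then show ?thesis using Y(1) Y'(1) by auto
qed

lemma T_card: "a \<in> K \<Longrightarrow> |T a| \<le>o l"
proof (induction a rule: less_induct)
  case (less a)
  from less(2) show ?case
  proof (cases rule: zero_suc_limit)
    case zero
    show ?thesis unfolding T_zero[OF zero] by (rule finite_le_l) simp
  next
    case (suc b)
    have "T a \<subseteq> T b \<union> insert b ` T b"
    proof
      fix Y assume "Y \<in> T a"
      then have Y: "Y \<subseteq> below a" "Y \<inter> below b \<in> T b" using T_suc[OF suc] by blast+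
      have "x = b \<or> x \<in> below b" if "x \<in> Y" for x
        using Y(1) that suc(2)[of x] le_less by auto
      then have "Y \<subseteq> insert b (below b)" by blast
      then have "Y = Y \<inter> below b \<or> Y = insert b (Y \<inter> below b)" by blast
      then show "Y \<in> T b \<union> insert b ` T b" using Y(2) by (metis Un_iff imageI)
    qed
    moreover have "|T b| \<le>o l" using less(1)[OF suc(1) down[OF less(2) suc(1)]] .
    ultimately show ?thesis using Un_le_l image_le_l subset_le_l by metis
  next
    case limit
    have "T a \<subseteq> (\<Union>C\<in>\<C> a. \<Union>z\<in>below a. \<Union>X\<in>T z. {Y. Y \<subseteq> below a \<and> climbs \<Psi> T C z X Y})"
    proof
      fix Y assume "Y \<in> T a"
      then obtain C z X where "C \<in> \<C> a" "z \<prec> a" "X \<in> T z" "climbs \<Psi> T C z X Y" "Y \<subseteq> below a"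
        using T_limit[OF limit] by blast
      then show "Y \<in> (\<Union>C\<in>\<C> a. \<Union>z\<in>below a. \<Union>X\<in>T z. {Y. Y \<subseteq> below a \<and> climbs \<Psi> T C z X Y})"
        by (intro UN_I) auto
    qed
    moreover have "|\<Union>C\<in>\<C> a. \<Union>z\<in>below a. \<Union>X\<in>T z. {Y. Y \<subseteq> below a \<and> climbs \<Psi> T C z X Y}| \<le>o l"
    proof (intro UN_le_l sq_card[OF limit] card_below[OF less(2)])
      fix z assume "z \<in> below a"
      then show "|T z| \<le>o l" using less(1) down[OF less(2)] by simp
    next
      fix C z X assume C: "C \<in> \<C> a" and z: "z \<in> below a"
      have "finite {Y. Y \<subseteq> below a \<and> climbs \<Psi> T C z X Y}" (is "finite ?A")
      proof (cases "?A = {}")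
        case False
        then obtain Y where "Y \<in> ?A" by blast
        then have "?A \<subseteq> {Y}" using climbs_unique[OF limit C] z by auto
        then show ?thesis using finite_subset by blast
      next
        case True
        show ?thesis unfolding True by (rule finite.emptyI)
      qed
      then show "|?A| \<le>o l" by (rule finite_le_l)
    qed
    ultimately show ?thesis by (rule subset_le_l)
  qed
qed

lemma T_nonempty: "a \<in> K \<Longrightarrow> T a \<noteq> {}"
proof -
  obtain m where m: "\<And>x. m \<preceq> x" using ex_least[of "\<lambda>_. True"] by blast
  then have "T m = {{}}" using leD by (intro T_zero) blast
  then show "a \<in> K \<Longrightarrow> T a \<noteq> {}" using T_extend[OF _ m] by blast
qed

end

subsection \<open>Antichains and chains\<close>

context tree_levels begin

definition nodes :: "('b \<times> 'b set) set"
  where "nodes = (SIGMA a:K. T a)"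

definition tree_le :: "'b \<times> 'b set \<Rightarrow> 'b \<times> 'b set \<Rightarrow> bool"
  where "tree_le p q \<longleftrightarrow> fst p \<preceq> fst q \<and> snd q \<inter> below (fst p) = snd p"

lemma tree_leD: "tree_le p q \<Longrightarrow> fst p \<preceq> fst q" "tree_le p q \<Longrightarrow> snd q \<inter> below (fst p) = snd p"
  unfolding tree_le_def by blast+

lemma nodesD: "p \<in> nodes \<Longrightarrow> fst p \<in> K" "p \<in> nodes \<Longrightarrow> snd p \<in> T (fst p)"
  unfolding nodes_def by auto

lemma tree_le_refl: "p \<in> nodes \<Longrightarrow> tree_le p p"
  using T_self nodesD(2) unfolding tree_le_def by blast

lemma tree_le_trans:
  assumes "tree_le p q" "tree_le q r"
  shows "tree_le p r"
  unfolding tree_le_def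
proof
  note a = tree_leD[OF assms(1)] and b = tree_leD[OF assms(2)]
  show "fst p \<preceq> fst r" using a(1) b(1) by order
  show "snd r \<inter> below (fst p) = snd p"
    using below_Int_eq[OF b(2) a(1)] a(2) b(2) below_Int[OF a(1), of "snd r"] by metis
qed

lemma tree_le_antisym:
  assumes "tree_le p q" "tree_le q p" "p \<in> nodes"
  shows "p = q"
proof -
  have "fst p = fst q" using tree_leD(1)[OF assms(1)] tree_leD(1)[OF assms(2)] by order
  then show ?thesis
    using tree_leD(2)[OF assms(2)] T_self[OF nodesD(2)[OF assms(3)]] by (metis prod.expand)
qed

lemma card_below_nodes:
  assumes a: "a \<in> K" and A: "A \<subseteq> nodes" "\<And>p. p \<in> A \<Longrightarrow> fst p \<prec> a"
  shows "|A| \<le>o l"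
proof (rule subset_le_l)
  show "A \<subseteq> (\<Union>b\<in>below a. Pair b ` T b)"
  proof
    fix p assume p: "p \<in> A"
    have "p = (fst p, snd p)" "snd p \<in> T (fst p)" "fst p \<in> below a"
      using A(2)[OF p] nodesD(2) A(1) p by auto
    then show "p \<in> (\<Union>b\<in>below a. Pair b ` T b)" by (metis UN_I imageI)
  qed
  show "|\<Union>b\<in>below a. Pair b ` T b| \<le>o l"
    using T_card down[OF a] by (intro UN_le_l card_below[OF a] image_le_l) simp
qed

definition antichain :: "('b \<times> 'b set) set \<Rightarrow> bool"
  where "antichain A \<longleftrightarrow> A \<subseteq> nodes \<and> (\<forall>p\<in>A. \<forall>q\<in>A. tree_le p q \<longrightarrow> p = q)"

text \<open>If the guess at a gap \<open>(u, v)\<close> is the set of chosen nodes above the nodes of level \<open>u\<close>, then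
  every branch climbing through that gap passes an element of the antichain.\<close>
lemma antichain_small:
  assumes \<Psi>: "\<And>F D. (\<And>x. x \<in> K \<Longrightarrow> F x \<noteq> {} \<and> F x \<subseteq> all_nodes \<and> |F x| \<le>o l) \<Longrightarrow> club D \<Longrightarrow>
      \<exists>a\<in>S. \<forall>C\<in>\<C> a. \<forall>e. e \<prec> a \<longrightarrow>
        (\<exists>u v. consecutive C u v \<and> e \<prec> u \<and> (\<exists>m\<in>D. u \<prec> m \<and> m \<preceq> v) \<and> \<Psi> u v = F u)"
    and A: "antichain A"
  shows "|A| \<le>o l"
proof -
  define good where "good u y p \<longleftrightarrow> p \<in> nodes \<and> u \<preceq> fst p \<and> snd p \<inter> below u = y" for u y p
  define above_A where "above_A p \<longleftrightarrow> (\<exists>q\<in>A. tree_le q p)" for p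
  \<comment> \<open>The chosen node \<open>z u y\<close> extends \<open>(u, y)\<close> and is above
    an element of \<open>A\<close> whenever some extension of \<open>(u, y)\<close> is.\<close>
  have "\<exists>p. good u y p \<and> ((\<exists>p. good u y p \<and> above_A p) \<longrightarrow> above_A p)" if "u \<in> K" "y \<in> T u" for u y
  proof -
    have "good u y (u, y)" using that T_self unfolding good_def nodes_def by auto
    then show ?thesis by blast
  qed
  then obtain z where z: "\<And>u y. u \<in> K \<Longrightarrow> y \<in> T u \<Longrightarrow> good u y (z u y)"
    "\<And>u y p. u \<in> K \<Longrightarrow> y \<in> T u \<Longrightarrow> good u y p \<Longrightarrow> above_A p \<Longrightarrow> above_A (z u y)"
    by metis
  define F where "F u = z u ` T u" for u
  have F: "F u \<noteq> {} \<and> F u \<subseteq> all_nodes \<and> |F u| \<le>o l" if u: "u \<in> K" for u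
  proof (intro conjI)
    show "F u \<noteq> {}" using T_nonempty[OF u] unfolding F_def by blast
    show "|F u| \<le>o l" unfolding F_def by (intro image_le_l T_card u)
    have "nodes \<subseteq> all_nodes" using T_below unfolding nodes_def all_nodes_def by blast
    then show "F u \<subseteq> all_nodes" using z(1)[OF u] unfolding F_def good_def by blast
  qed
  have "\<exists>b\<in>K. \<forall>y\<in>T u. fst (z u y) \<prec> b" if u: "u \<in> K" for u
    using z(1)[OF u] nodesD(1) unfolding good_def by (intro bounded_image T_card[OF u]) blast
  then obtain g where g: "\<And>u. u \<in> K \<Longrightarrow> g u \<in> K" "\<And>u y. u \<in> K \<Longrightarrow> y \<in> T u \<Longrightarrow> fst (z u y) \<prec> g u"
    by metis
  \<comment> \<open>A point of \<open>D\<close> in the gap above \<open>u\<close> places every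
    \<open>z u y\<close> at a level below \<open>v\<close>, within reach of a branch crossing the
    gap.\<close>
  define D where "D = {d\<in>K. (\<exists>x. x \<prec> d) \<and> (\<forall>x. x \<prec> d \<longrightarrow> g x \<prec> d)}"
  have "club D" unfolding D_def by (rule club_closure[OF g(1)])
  obtain a where a: "a \<in> S" "\<And>C e. C \<in> \<C> a \<Longrightarrow> e \<prec> a \<Longrightarrow>
      \<exists>u v. consecutive C u v \<and> e \<prec> u \<and> (\<exists>m\<in>D. u \<prec> m \<and> m \<preceq> v) \<and> \<Psi> u v = F u"
    using \<Psi>[of F D, OF F \<open>club D\<close>] by meson
  note lim = S_limit[OF a(1)] and aK = S_K[OF a(1)]
  have "fst p \<prec> a" if p: "p \<in> A" for p
  proof (rule ccontr)
    assume "\<not> fst p \<prec> a"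
    then have ap: "a \<preceq> fst p" by order
    have pn: "p \<in> nodes" using A p unfolding antichain_def by blast
    define Y where "Y = snd p \<inter> below a"
    have "Y \<in> T a" unfolding Y_def using T_restrict[OF nodesD(1,2)[OF pn] ap] .
    then obtain C x X where C: "C \<in> \<C> a" "x \<prec> a" "X \<in> T x" "climbs \<Psi> T C x X Y"
      using T_limit[OF lim] by blast
    obtain u v m where uv: "consecutive C u v" "x \<prec> u" "m \<in> D" "u \<prec> m" "m \<preceq> v" "\<Psi> u v = F u"
      using a(2)[OF C(1,2)] by blast
    have "u \<in> C" "v \<in> C" using uv(1) unfolding consecutive_def by blast+
    then have "u \<prec> a" "v \<prec> a" using sq_less[OF lim C(1)] by blast+
    then have uK: "u \<in> K" and vK: "v \<in> K" using down[OF aK] by blast+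
    define y where "y = Y \<inter> below u"
    have y: "y \<in> T u" unfolding y_def using T_climbs[OF lim C \<open>u \<in> C\<close> uv(2)] .
    have Yp: "Y \<inter> below w = snd p \<inter> below w" if "w \<preceq> a" for w
      unfolding Y_def using below_Int[OF that] .
    have "y = snd p \<inter> below u" unfolding y_def using Yp[OF less_imp_le[OF \<open>u \<prec> a\<close>]] .
    moreover have "u \<preceq> fst p" using \<open>u \<prec> a\<close> ap by order
    ultimately have "good u y p" using pn unfolding good_def by blast
    moreover have "above_A p" using p tree_le_refl[OF pn] unfolding above_A_def by blast
    ultimately have "above_A (z u y)" using z(2)[OF uK y] by blast
    then obtain q where q: "q \<in> A" "tree_le q (z u y)" unfolding above_A_def by blast
    have zg: "z u y \<in> nodes" "u \<preceq> fst (z u y)" "snd (z u y) \<inter> below u = y"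
      using z(1)[OF uK y] unfolding good_def by blast+
    have "g u \<prec> m" using uv(3,4) unfolding D_def by blast
    then have zv: "fst (z u y) \<prec> v" using g(2)[OF uK y] uv(5) by order
    \<comment> \<open>\<open>Y'\<close> shows that the guess can be hit above \<open>y\<close>, so
      the value of \<open>ext\<close> has to hit it.\<close>
    obtain Y' where Y': "Y' \<in> T v" "Y' \<inter> below (fst (z u y)) = snd (z u y)"
      using T_extend[OF vK less_imp_le[OF zv] nodesD(2)[OF zg(1)]] by blast
    have "Y' \<inter> below u = y" using below_Int_eq[OF Y'(2) zg(2)] zg(3) Y'(2) below_Int[OF zg(2), of Y'] by metis
    moreover have "hits \<Psi> u v Y'"
      unfolding hits_def uv(6) F_def
      using y Y'(2) less_imp_le[OF zv] by (intro bexI[of _ "z u y"] imageI) (auto simp: case_prod_beta)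
    moreover have "consecutive (tail C x) u v" using consecutive_tail[OF uv(1,2)] .
    then have "Y \<inter> below v = ext \<Psi> (T v) u y v"
      using C(4) unfolding climbs_def y_def by blast
    ultimately have "hits \<Psi> u v (Y \<inter> below v)"
      using ext_props(3)[of v u y Y'] Y'(1) by auto
    then obtain w W where w: "(w, W) \<in> F u" "w \<preceq> v" "Y \<inter> below v \<inter> below w = W"
      unfolding hits_def uv(6) by blast
    then obtain y' where y': "y' \<in> T u" "(w, W) = z u y'" unfolding F_def by blast
    have g': "u \<preceq> w" "W \<inter> below u = y'"
      using z(1)[OF uK y'(1)] unfolding good_def y'(2)[symmetric] by auto
    have YW: "Y \<inter> below w = W" using w(3) below_Int[OF w(2)] by simp
    \<comment> \<open>\<open>F u\<close> also contains the nodes chosen for other members of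
      \<open>T u\<close>; the one hit by \<open>Y\<close> can only be the one chosen for
      \<open>y\<close>.\<close>
    have "y' = y" unfolding y_def using below_Int_eq[OF YW g'(1)] g'(2) YW below_Int[OF g'(1), of Y] by metis
    then have zw: "z u y = (w, W)" using y'(2) by simp
    have "w \<preceq> a" using w(2) \<open>v \<prec> a\<close> by order
    then have "snd p \<inter> below w = W" using Yp YW by metis
    moreover have "w \<preceq> fst p" using \<open>w \<preceq> a\<close> ap by order
    ultimately have "tree_le (w, W) p" unfolding tree_le_def by simp
    \<comment> \<open>Both \<open>q\<close> and \<open>p\<close> are in the antichain, so they
      coincide, although \<open>q\<close> has level at most \<open>v\<close> and \<open>p\<close>
      has level at least \<open>a\<close>.\<close>
    then have "tree_le q p" using q(2) tree_le_trans unfolding zw by blast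
    then have "q = p" using A q(1) p unfolding antichain_def by blast
    moreover have "fst q \<preceq> w" using tree_leD(1)[OF q(2)] unfolding zw by simp
    ultimately have "fst p \<preceq> w" by simp
    then have "a \<preceq> v" using ap w(2) by order
    then show False using \<open>v \<prec> a\<close> by order
  qed
  then show ?thesis
    using A aK unfolding antichain_def by (intro card_below_nodes) auto
qed

text \<open>A long chain yields the antichain of the nodes that leave it by one step.\<close>
lemma chain_small:
  assumes anti: "\<And>A. antichain A \<Longrightarrow> |A| \<le>o l"
    and B: "B \<subseteq> nodes" "\<And>p q. p \<in> B \<Longrightarrow> q \<in> B \<Longrightarrow> tree_le p q \<or> tree_le q p"
  shows "|B| \<le>o l"
proof (rule ccontr)
  assume "\<not> ?thesis"
  then have "\<exists>p\<in>B. a \<prec> fst p" if a: "a \<in> K" for a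
  proof -
    obtain b where "b \<in> K" "a \<prec> b" using ex_above[OF a] by blast
    then obtain p where "p \<in> B" "\<not> fst p \<prec> b"
      using card_below_nodes[OF _ B(1)] \<open>\<not> |B| \<le>o l\<close> by blast
    then show ?thesis using \<open>a \<prec> b\<close> by (meson less_le_trans not_le)
  qed
  then obtain p where p: "\<And>a. a \<in> K \<Longrightarrow> p a \<in> B \<and> a \<prec> fst (p a)" by metis
  obtain s where s: "\<And>a. a \<in> K \<Longrightarrow> s a \<in> K \<and> a \<prec> s a \<and> (\<forall>x. x \<prec> s a \<longrightarrow> x \<preceq> a)"
    using ex_suc by metis
  \<comment> \<open>\<open>Q a\<close> follows the branch below \<open>a\<close> and takes the
    opposite value at \<open>a\<close>. For \<open>a \<prec> b\<close>, the set \<open>Q b\<close>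
    still follows the branch at \<open>a\<close>, so the two nodes are incomparable.\<close>
  define Q where "Q a = snd (p a) \<inter> below a \<union> ({a} - snd (p a))" for a
  have Qa: "a \<in> Q a \<longleftrightarrow> a \<notin> snd (p a)" for a unfolding Q_def by auto
  have nodes: "(s a, Q a) \<in> nodes" if a: "a \<in> K" for a
  proof -
    have pa: "p a \<in> nodes" using p[OF a] B(1) by blast
    have "a \<preceq> fst (p a)" using p[OF a] less_imp_le by blast
    then have "snd (p a) \<inter> below a \<in> T a"
      using T_restrict[OF nodesD[OF pa]] by blast
    moreover have "Q a \<inter> below a = snd (p a) \<inter> below a" unfolding Q_def by auto
    moreover have "Q a \<subseteq> below (s a)" using s[OF a] less_trans unfolding Q_def by auto
    ultimately have "Q a \<in> T (s a)" using T_suc[of a "s a"] s[OF a] by simp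
    then show ?thesis using s[OF a] unfolding nodes_def by simp
  qed
  have agree: "x \<in> snd (p a) \<longleftrightarrow> x \<in> snd (p b)" if "a \<in> K" "b \<in> K" "x \<prec> fst (p a)" "x \<prec> fst (p b)" for a b x
    using B(2)[of "p a" "p b"] p[OF that(1)] p[OF that(2)] that(3,4) unfolding tree_le_def
    by (metis IntE IntI mem_below)
  have incomp: "\<not> tree_le (s a, Q a) (s b, Q b)" if "a \<in> K" "b \<in> K" "a \<noteq> b" for a b
  proof
    assume le: "tree_le (s a, Q a) (s b, Q b)"
    then have "s a \<preceq> s b" "Q b \<inter> below (s a) = Q a" unfolding tree_le_def by auto
    have "a \<prec> s b" using s[OF that(1)] \<open>s a \<preceq> s b\<close> less_le_trans by blast
    then have ab: "a \<prec> b" using s[OF that(2)] that(3) le_less by blast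
    have "a \<in> Q b \<longleftrightarrow> a \<in> Q a"
      using \<open>Q b \<inter> below (s a) = Q a\<close> s[OF that(1)] by auto
    moreover have "a \<in> Q b \<longleftrightarrow> a \<in> snd (p b)" using ab unfolding Q_def by auto
    moreover have "a \<in> snd (p b) \<longleftrightarrow> a \<in> snd (p a)"
      using agree[OF that(2,1)] p[OF that(1)] p[OF that(2)] ab less_trans by blast
    ultimately show False using Qa by blast
  qed
  have "antichain ((\<lambda>a. (s a, Q a)) ` K)"
    unfolding antichain_def using nodes incomp by blast
  moreover have "inj_on (\<lambda>a. (s a, Q a)) K"
    using incomp tree_le_refl[OF nodes] by (intro inj_onI) metis
  ultimately have "|K| \<le>o l"
    using anti card_of_ordLeq[of K "(\<lambda>a. (s a, Q a)) ` K"] ordLeq_transitive by blast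
  then show False
    using bounded[of K] less_irrefl by blast
qed

end

subsection \<open>Cardinal arithmetic and the tree order\<close>

text \<open>A well-order of the complement is placed on top of \<open>k\<close>. This supplies the
  carrier-free order that \<open>succ_card\<close> works with.\<close>

lemma well_order_on_UNIV_extend:
  assumes "Well_order k"
  shows "\<exists>r. well_order_on UNIV r \<and> k \<subseteq> r \<and> (\<forall>x y. (x, y) \<in> r \<longrightarrow> y \<in> Field k \<longrightarrow> (x, y) \<in> k)"
proof -
  obtain w :: "'a rel" where "well_order_on (- Field k) w"
    using well_order_on by blast
  then have w: "Well_order w" and Fw: "Field w = - Field k"
    using well_order_on_Field well_order_on_Well_order by blast+
  let ?r = "k \<union> w \<union> Field k \<times> (- Field k)"
  have k: "refl_on (Field k) k" "k \<subseteq> Field k \<times> Field k" "trans k" "antisym k" "total_on (Field k) k" "wf (k - Id)"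
    and w': "refl_on (- Field k) w" "w \<subseteq> (- Field k) \<times> (- Field k)" "trans w" "antisym w" "total_on (- Field k) w" "wf (w - Id)"
    using assms w unfolding order_on_defs Fw by (auto simp: Field_def Fw[symmetric])
  have "refl ?r" using k(1) w'(1) unfolding refl_on_def by blast
  moreover have "trans ?r"
    using k(2,3) w'(2,3) unfolding trans_def by blast
  moreover have "antisym ?r"
    using k(2,4) w'(2,4) unfolding antisym_def by blast
  moreover have "total ?r"
    using k(5) w'(5) unfolding total_on_def by blast
  moreover have "wf (?r - Id)"
    unfolding wf_eq_minimal
  proof (intro allI impI)
    fix Q and x :: 'a assume "x \<in> Q"
    show "\<exists>z\<in>Q. \<forall>y. (y, z) \<in> ?r - Id \<longrightarrow> y \<notin> Q"
    proof (cases "Q \<inter> Field k = {}")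
      case True
      then obtain z where "z \<in> Q" "\<And>y. (y, z) \<in> w - Id \<Longrightarrow> y \<notin> Q"
        using w'(6) \<open>x \<in> Q\<close> unfolding wf_eq_minimal by metis
      then show ?thesis using True k(2) by blast
    next
      case False
      then obtain z where "z \<in> Q \<inter> Field k" "\<And>y. (y, z) \<in> k - Id \<Longrightarrow> y \<notin> Q \<inter> Field k"
        using k(6) unfolding wf_eq_minimal by (metis ex_in_conv)
      then show ?thesis using k(2) w'(2) by blast
    qed
  qed
  ultimately have "well_order_on UNIV ?r"
    unfolding order_on_defs by simp
  then show ?thesis using k(2) w'(2) by blast
qed

lemma wellorder_of_well_order_on:
  assumes "well_order_on UNIV r"
  shows "class.wellorder (\<lambda>x y. (x, y) \<in> r) (\<lambda>x y. (x, y) \<in> r \<and> x \<noteq> y)"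
proof -
  have r: "refl r" "trans r" "antisym r" "total r" "wf (r - Id)"
    using assms unfolding order_on_defs by auto
  show ?thesis
  proof (unfold_locales, goal_cases)
    case (1 x y) then show ?case using r(3) by (auto dest: antisymD)
  next
    case (2 x) then show ?case using r(1) by (auto dest: refl_onD)
  next
    case (3 x y z) then show ?case using r(2) by (auto dest: transD)
  next
    case (4 x y) then show ?case using r(3) by (auto dest: antisymD)
  next
    case (5 x y) then show ?case using r(1,4) unfolding total_on_def refl_on_def by (cases "x = y") auto
  next
    case (6 P a)
    then show ?case using wf_induct_rule[OF r(5), of P a] by auto
  qed
qed

text \<open>Koenig's diagonal argument: if \<open>l\<close> were a union of \<open>|P| < l\<close> small pieces, no enumeration of
  length \<open>l\<close> could exhaust the functions from \<open>P\<close> to \<open>l\<close>.\<close>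
lemma pigeonhole_cexp_less:
  fixes l :: "'a rel"
  assumes l: "Card_order l" and exp: "cexp_less l =o l"
    and P: "|P| <o l" and p: "p ` Field l \<subseteq> P"
  shows "\<exists>y. \<not> |{i\<in>Field l. p i = y}| <o l"
proof (rule ccontr)
  assume neg: "\<not> ?thesis"
  have wo: "Well_order l" using l by (rule card_order_on_well_order_on)
  obtain m where m: "m \<in> Field l" "|P| =o Restr l (underS l m)"
    using P ordLess_iff_ordIso_Restr[OF wo card_of_Well_order] by blast
  \<comment> \<open>\<open>P\<close> is copied into the initial segment \<open>underS l m\<close>,
    because \<open>cexp_less\<close> counts functions defined on initial segments.\<close>
  have "Field (Restr l (underS l m)) \<subseteq> underS l m" by (rule Field_Restr_subset)
  then have "|P| \<le>o |underS l m|"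
    using card_of_cong[OF m(2)] card_of_mono1 ordIso_ordLeq_trans unfolding Field_card_of by blast
  then obtain c where c: "inj_on c P" "c ` P \<subseteq> underS l m"
    unfolding card_of_ordLeq[symmetric] by blast
  let ?F = "Func (underS l m) (Field l)"
  have "inj_on (Pair m) ?F" by (rule inj_onI) simp
  moreover have "Pair m ` ?F \<subseteq> (SIGMA a : Field l. Func (underS l a) (Field l))" using m(1) by blast
  ultimately have "|?F| \<le>o cexp_less l"
    unfolding cexp_less_def card_of_ordLeq[symmetric] by blast
  then have "|?F| \<le>o |Field l|"
    using exp card_of_Field_ordIso[OF l] ordIso_symmetric ordIso_transitive ordLeq_ordIso_trans by blast
  then obtain e where e: "inj_on e ?F" "e ` ?F \<subseteq> Field l"
    unfolding card_of_ordLeq[symmetric] by blast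
  \<comment> \<open>The functions with indices labelled \<open>y\<close> take fewer than
    \<open>l\<close> values at coordinate \<open>c y\<close>. The diagonal function takes a missing
    value there and so differs from all of them.\<close>
  have "\<exists>x\<in>Field l. x \<notin> (\<lambda>i. inv_into ?F e i (c y)) ` {i\<in>Field l. p i = y}" for y
  proof (rule ccontr)
    assume "\<not> ?thesis"
    then have "|Field l| \<le>o |(\<lambda>i. inv_into ?F e i (c y)) ` {i\<in>Field l. p i = y}|"
      by (intro card_of_mono1) blast
    then have "|Field l| <o l"
      using card_of_image neg ordLeq_ordLess_trans by blast
    then show False
      using card_of_Field_ordIso[OF l] not_ordLess_ordIso by blast
  qed
  then obtain g where g: "\<And>y. g y \<in> Field l" "\<And>y. g y \<notin> (\<lambda>i. inv_into ?F e i (c y)) ` {i\<in>Field l. p i = y}"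
    by metis
  define G where "G j = (if j \<in> underS l m then g (inv_into P c j) else undefined)" for j
  have G: "G \<in> ?F" unfolding Func_def G_def using g(1) by auto
  have i: "e G \<in> Field l" using G e(2) by blast
  then have y: "p (e G) \<in> P" using p by blast
  have "inv_into ?F e (e G) (c (p (e G))) = G (c (p (e G)))"
    using inv_into_f_f[OF e(1) G] by simp
  also have "\<dots> = g (p (e G))"
    using c y inv_into_f_f[OF c(1) y] unfolding G_def by auto
  finally show False
    using g(2)[of "p (e G)"] i by (metis (mono_tags, lifting) image_eqI mem_Collect_eq)
qed

lemma card_of_Pow_mono:
  assumes "|A| \<le>o |B|"
  shows "|Pow A| \<le>o |Pow B|"
proof -
  obtain f where f: "inj_on f A" "f ` A \<subseteq> B"
    using assms unfolding card_of_ordLeq[symmetric] by blast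
  have "inj_on ((`) f) (Pow A)" by (rule inj_on_image_Pow[OF f(1)])
  moreover have "(`) f ` Pow A \<subseteq> Pow B" using f(2) by auto
  ultimately show ?thesis unfolding card_of_ordLeq[symmetric] by blast
qed

section \<open>Counting with \<open>2\<^sup>l = k\<close>\<close>

context succ_card begin

text \<open>A nonempty set of size at most \<open>l\<close> is an image of \<open>Field l\<close>,
  so an \<open>l\<close>-sequence of such sets is coded by a function from
  \<open>Field l \<times> Field l\<close> to \<open>K\<close>; there are
  \<open>(2\<^sup>l)\<^sup>l = 2\<^sup>l\<close> of these. This supplies the codes used in
  \<open>guessing\<close>.\<close>

lemma ex_enumeration:
  assumes pow: "|K| =o ctwo ^c l" and N: "N \<noteq> {}" "|N| \<le>o |K|"
  shows "\<exists>f :: 'b \<Rightarrow> 'a \<Rightarrow> 'c set. \<forall>g. (\<forall>i\<in>Field l. g i \<noteq> {} \<and> g i \<subseteq> N \<and> |g i| \<le>o l) \<longrightarrow>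
    (\<exists>b\<in>K. \<forall>i\<in>Field l. f b i = g i)"
proof -
  obtain e where e: "e ` K = N"
    using N card_of_ordLeq2[of N K] by blast
  let ?F = "Func (Field l \<times> Field l) K"
  have co: "Card_order (l *c l)" "Card_order ctwo" by (rule Card_order_cprod Card_order_ctwo)+
  have "|?F| =o |K| ^c (l *c l)"
    unfolding cexp_def cprod_def Field_card_of by (rule card_of_refl)
  also have "|K| ^c (l *c l) =o (ctwo ^c l) ^c (l *c l)"
    by (rule cexp_cong1[OF pow co(1)])
  also have "(ctwo ^c l) ^c (l *c l) =o ctwo ^c (l *c (l *c l))"
    by (rule cexp_cprod[OF co(2)])
  also have "ctwo ^c (l *c (l *c l)) =o ctwo ^c l"
  proof (rule cexp_cong2[OF _ co(2) Card_order_cprod])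
    have "l *c (l *c l) =o l *c l"
      using cprod_cong2[OF cprod_infinite[OF Cinfinite_l]] .
    also have "l *c l =o l" by (rule cprod_infinite[OF Cinfinite_l])
    finally show "l *c (l *c l) =o l" .
  qed
  also have "ctwo ^c l =o |K|" using pow by (rule ordIso_symmetric)
  finally have "|?F| \<le>o |K|" by (rule ordIso_imp_ordLeq)
  moreover have "?F \<noteq> {}"
    using K_nonempty by (auto simp: Func_is_emp)
  ultimately obtain h where h: "h ` K = ?F"
    using card_of_ordLeq2[of ?F K] by blast
  have coded: "\<exists>b\<in>K. \<forall>i\<in>Field l. (\<lambda>j. e (h b (i, j))) ` Field l = g i"
    if g: "\<And>i. i \<in> Field l \<Longrightarrow> g i \<noteq> {} \<and> g i \<subseteq> N \<and> |g i| \<le>o l" for g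
  proof -
    have "\<exists>m. (\<forall>j\<in>Field l. m j \<in> K) \<and> (\<lambda>j. e (m j)) ` Field l = g i" if i: "i \<in> Field l" for i
    proof -
      have "|g i| \<le>o |Field l|"
        using g[OF i] ordIso_symmetric[OF card_Field_l] ordLeq_ordIso_trans by blast
      then obtain n where n: "n ` Field l = g i"
        using g[OF i] card_of_ordLeq2[of "g i" "Field l"] by blast
      have "\<exists>b\<in>K. e b = n j" if "j \<in> Field l" for j
      proof -
        have "n j \<in> e ` K" using n g[OF i] that unfolding e by blast
        then show ?thesis by (metis imageE)
      qed
      then obtain m where "\<And>j. j \<in> Field l \<Longrightarrow> m j \<in> K \<and> e (m j) = n j" by metis
      then show ?thesis using n by (intro exI[of _ m]) auto
    qed
    then obtain m where m: "\<And>i j. i \<in> Field l \<Longrightarrow> j \<in> Field l \<Longrightarrow> m i j \<in> K"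
      "\<And>i. i \<in> Field l \<Longrightarrow> (\<lambda>j. e (m i j)) ` Field l = g i" by metis
    define M where "M q = (if q \<in> Field l \<times> Field l then m (fst q) (snd q) else undefined)" for q
    have "M \<in> ?F" unfolding Func_def M_def using m(1) by auto
    then obtain b where b: "b \<in> K" "h b = M" using h by (metis imageE)
    have "(\<lambda>j. e (h b (i, j))) ` Field l = g i" if "i \<in> Field l" for i
      unfolding b(2) m(2)[OF that, symmetric] using that by (intro image_cong) (auto simp: M_def)
    then show ?thesis using b(1) by blast
  qed
  show ?thesis
    by (intro exI[of _ "\<lambda>b i. (\<lambda>j. e (h b (i, j))) ` Field l"] allI impI coded) simp
qed

lemma card_all_nodes:
  assumes "|K| =o ctwo ^c l"
  shows "|all_nodes| \<le>o |K|"
  unfolding all_nodes_def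
proof (rule card_of_Sigma_ordLeq_infinite)
  show "infinite K"
    using bounded[OF subset_refl] finite_le_l less_irrefl by blast
  show "|K| \<le>o |K|" by (rule ordLeq_refl[OF card_of_Card_order])
  show "\<forall>a\<in>K. |Pow (below a)| \<le>o |K|"
  proof
    fix a assume "a \<in> K"
    then have "|Pow (below a)| \<le>o |Pow (Field l)|"
      using card_below ordIso_symmetric[OF card_Field_l] ordLeq_ordIso_trans by (intro card_of_Pow_mono) blast
    also have "|Pow (Field l)| =o ctwo ^c l"
      unfolding cexp_def ctwo_def Field_card_of by (rule card_of_Pow_Func)
    also have "ctwo ^c l =o |K|" using assms by (rule ordIso_symmetric)
    finally show "|Pow (below a)| \<le>o |K|" .
  qed
qed

end

context tree_levels
begin

text \<open>The nodes are pairs; since there are at most \<open>|K|\<close> of them, an injection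
  \<open>j\<close> carries their order to the type of \<open>k\<close>.\<close>

lemma ex_Souslin_tree:
  fixes k :: "'b rel"
  assumes k: "Card_order k" "l <o k" and K: "Field k = K"
    and k_le: "\<And>x y. (x, y) \<in> k \<longleftrightarrow> x \<in> K \<and> y \<in> K \<and> x \<preceq> y"
    and nodes: "|nodes| \<le>o |K|"
    and anti: "\<And>A. antichain A \<Longrightarrow> |A| \<le>o l"
  shows "\<exists>R :: 'b rel. Souslin_tree k R"
proof -
  obtain j :: "'b \<times> 'b set \<Rightarrow> 'b" where j: "inj_on j nodes"
    using nodes unfolding card_of_ordLeq[symmetric] by blast
  define R where "R = {(j p, j q) | p q. p \<in> nodes \<and> q \<in> nodes \<and> tree_le p q}"
  have jR: "(j p, j q) \<in> R \<longleftrightarrow> tree_le p q" if "p \<in> nodes" "q \<in> nodes" for p q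
    using that inj_onD[OF j] unfolding R_def by blast
  have FR: "Field R = j ` nodes"
  proof
    show "Field R \<subseteq> j ` nodes" unfolding R_def Field_def by blast
    show "j ` nodes \<subseteq> Field R" using jR tree_le_refl unfolding Field_def by blast
  qed
  have wok: "Well_order k" using k(1) by (rule card_order_on_well_order_on)
  have "refl_on (Field R) R" unfolding refl_on_def FR using jR tree_le_refl by blast
  moreover have "R \<subseteq> Field R \<times> Field R" unfolding Field_def by auto
  moreover have "trans R"
  proof (rule transI)
    fix x y z assume "(x, y) \<in> R" "(y, z) \<in> R"
    then obtain p q q' r where "x = j p" "y = j q" "y = j q'" "z = j r" "tree_le p q" "tree_le q' r"
      "p \<in> nodes" "q \<in> nodes" "q' \<in> nodes" "r \<in> nodes" unfolding R_def by blast
    then show "(x, z) \<in> R" using inj_onD[OF j] tree_le_trans jR by metis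
  qed
  moreover have "antisym R"
  proof (rule antisymI)
    fix x y assume "(x, y) \<in> R" "(y, x) \<in> R"
    moreover from this(1) obtain p q where "x = j p" "y = j q" "p \<in> nodes" "q \<in> nodes"
      unfolding R_def by blast
    ultimately show "x = y" using jR tree_le_antisym by metis
  qed
  ultimately have po: "Partial_order R" unfolding order_on_defs by simp
  define below_k where "below_k a = Restr k (underS k a)" for a
  have uk: "underS k a = below a" if "a \<in> K" for a
    unfolding underS_def using that k_le down le_less by auto
  have below_k: "(x, y) \<in> below_k a \<longleftrightarrow> x \<prec> a \<and> y \<prec> a \<and> x \<preceq> y" if "a \<in> K" for a x y
    unfolding below_k_def uk[OF that] using k_le down[OF that] by auto
  have wob: "Well_order (below_k a)" for a
    unfolding below_k_def using wok by (rule Well_order_Restr)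
  \<comment> \<open>The proper predecessors of \<open>p\<close> are its restrictions, one for each
    ordinal below its level, so order-theoretic levels agree with the recorded ones.\<close>
  have preds: "Restr R (underS R (j p)) =o below_k (fst p) \<and> Well_order (Restr R (underS R (j p)))"
    if p: "p \<in> nodes" for p
  proof -
    define f where "f b = (b, snd p \<inter> below b)" for b
    have pK: "fst p \<in> K" using nodesD(1)[OF p] .
    have f: "f b \<in> nodes" "tree_le (f b) p" "f b \<noteq> p" if "b \<prec> fst p" for b
    proof -
      show "f b \<in> nodes"
        using T_restrict[OF nodesD[OF p] less_imp_le[OF that]] down[OF pK that] unfolding f_def nodes_def by simp
      show "tree_le (f b) p" unfolding tree_le_def f_def using less_imp_le[OF that] by simp
      show "f b \<noteq> p" using that less_irrefl unfolding f_def by (metis fst_conv)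
    qed
    have f_inv: "q = f (fst q)" "fst q \<prec> fst p" if "q \<in> nodes" "tree_le q p" "q \<noteq> p" for q
    proof -
      show q: "q = f (fst q)" using tree_leD(2)[OF that(2)] unfolding f_def by (metis prod.collapse)
      have "fst q \<noteq> fst p"
        using that(3) q T_self[OF nodesD(2)[OF p]] unfolding f_def by (metis prod.collapse)
      then show "fst q \<prec> fst p" using tree_leD(1)[OF that(2)] by order
    qed
    have f_le: "tree_le (f b) (f c) \<longleftrightarrow> b \<preceq> c" for b c
      unfolding tree_le_def f_def using below_Int by auto
    have U: "underS R (j p) = (j \<circ> f) ` below (fst p)"
    proof
      show "underS R (j p) \<subseteq> (j \<circ> f) ` below (fst p)"
      proof
        fix x assume "x \<in> underS R (j p)"
        then have "(x, j p) \<in> R" "x \<noteq> j p" unfolding underS_def by auto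
        then obtain q where q: "x = j q" "q \<in> nodes" "tree_le q p" "q \<noteq> p"
          using inj_onD[OF j] p unfolding R_def by blast
        then show "x \<in> (j \<circ> f) ` below (fst p)"
          using f_inv[OF q(2-4)] by (intro image_eqI[of _ _ "fst q"]) auto
      qed
      show "(j \<circ> f) ` below (fst p) \<subseteq> underS R (j p)"
      proof
        fix x assume "x \<in> (j \<circ> f) ` below (fst p)"
        then obtain b where b: "b \<prec> fst p" "x = j (f b)" by auto
        have "j (f b) \<noteq> j p" using inj_onD[OF j _ f(1)[OF b(1)] p] f(3)[OF b(1)] by blast
        then show "x \<in> underS R (j p)"
          unfolding underS_def b(2) using jR[OF f(1)[OF b(1)] p] f(2)[OF b(1)] by blast
      qed
    qed
    have inj: "inj_on (j \<circ> f) (below (fst p))"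
    proof (rule inj_onI)
      fix b c assume "b \<in> below (fst p)" "c \<in> below (fst p)" "(j \<circ> f) b = (j \<circ> f) c"
      then have "f b = f c" using inj_onD[OF j, of "f b" "f c"] f(1) by simp
      then show "b = c" unfolding f_def by simp
    qed
    have R_f: "(j (f b), j (f c)) \<in> R \<longleftrightarrow> b \<preceq> c" if "b \<prec> fst p" "c \<prec> fst p" for b c
      using jR[OF f(1)[OF that(1)] f(1)[OF that(2)]] f_le by simp
    have "Restr R (underS R (j p)) = dir_image (below_k (fst p)) (j \<circ> f)"
    proof (intro subset_antisym subrelI)
      fix x y assume xy: "(x, y) \<in> Restr R (underS R (j p))"
      then obtain b c where bc: "b \<prec> fst p" "c \<prec> fst p" "x = j (f b)" "y = j (f c)"
        unfolding U by auto
      then have "(b, c) \<in> below_k (fst p)" using xy R_f[OF bc(1,2)] below_k[OF pK] by blast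
      then show "(x, y) \<in> dir_image (below_k (fst p)) (j \<circ> f)"
        unfolding dir_image_def using bc by auto
    next
      fix x y assume "(x, y) \<in> dir_image (below_k (fst p)) (j \<circ> f)"
      then obtain b c where bc: "(b, c) \<in> below_k (fst p)" "x = j (f b)" "y = j (f c)"
        unfolding dir_image_def by auto
      then have "b \<prec> fst p" "c \<prec> fst p" "b \<preceq> c" using below_k[OF pK] by blast+
      then show "(x, y) \<in> Restr R (underS R (j p))"
        unfolding U using R_f[of b c] bc by auto
    qed
    moreover have "Field (below_k (fst p)) \<subseteq> below (fst p)"
      unfolding below_k_def uk[OF pK] by (rule Field_Restr_subset)
    then have "inj_on (j \<circ> f) (Field (below_k (fst p)))" using inj inj_on_subset by blast
    ultimately show ?thesis
      using dir_image_ordIso[OF wob] Well_order_dir_image[OF wob] ordIso_symmetric by metis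
  qed
  have "is_tree R"
    unfolding is_tree_def
  proof
    show "\<forall>x\<in>Field R. Well_order (Restr R (underS R x))"
      unfolding FR using preds by blast
  qed (rule po)
  moreover have "tree_has_height R k"
    unfolding tree_has_height_def
  proof
    have "\<not> Restr R (underS R (j p)) =o k" if p: "p \<in> nodes" for p
    proof
      assume "Restr R (underS R (j p)) =o k"
      then have "below_k (fst p) =o k"
        using preds[OF p] ordIso_symmetric ordIso_transitive by blast
      moreover have "Field k \<noteq> {}" using nodesD(1)[OF p] K by blast
      then have "below_k (fst p) <o k"
        unfolding below_k_def using underS_Restr_ordLess[OF wok] by blast
      ultimately show False using not_ordLess_ordIso by blast
    qed
    then show "tree_level R k = {}" unfolding tree_level_def FR by blast
    show "\<forall>a\<in>Field k. tree_level R (Restr k (underS k a)) \<noteq> {}"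
    proof
      fix a assume "a \<in> Field k"
      then obtain X where "X \<in> T a" "a \<in> K" using T_nonempty K by blast
      then have "(a, X) \<in> nodes" unfolding nodes_def by blast
      then show "tree_level R (Restr k (underS k a)) \<noteq> {}"
        using preds unfolding tree_level_def FR below_k_def by fastforce
    qed
  qed
  moreover have small: "\<not> |j ` B| =o k" if "|B| \<le>o l" for B
    using image_le_l[OF that, of j] k(2) ordLeq_ordLess_trans not_ordLess_ordIso by blast
  have "\<not> |A| =o k" if A: "A \<in> Chains R" for A
  proof -
    have AR: "(x, y) \<in> R \<or> (y, x) \<in> R" if "x \<in> A" "y \<in> A" for x y
      using A that unfolding Chains_def by blast
    then have "A \<subseteq> j ` nodes" unfolding FR[symmetric] Field_def by blast
    then obtain B where B: "B \<subseteq> nodes" "A = j ` B" unfolding subset_image_iff by blast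
    have "|B| \<le>o l"
      using AR jR B by (intro chain_small[OF anti B(1)]) blast+
    then show ?thesis unfolding B(2) by (rule small)
  qed
  moreover have "\<not> |A| =o k" if A: "A \<in> antichains R" for A
  proof -
    have AR: "A \<subseteq> j ` nodes" "\<And>x y. x \<in> A \<Longrightarrow> y \<in> A \<Longrightarrow> x \<noteq> y \<Longrightarrow> (x, y) \<notin> R"
      using A unfolding antichains_def FR by auto
    obtain B where B: "B \<subseteq> nodes" "A = j ` B" using AR(1) unfolding subset_image_iff by blast
    have "p = q" if "p \<in> B" "q \<in> B" "tree_le p q" for p q
    proof -
      have "p \<in> nodes" "q \<in> nodes" using that B(1) by blast+
      then show ?thesis
        using AR(2)[of "j p" "j q"] jR[of p q] that B(2) inj_onD[OF j, of p q] by blast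
    qed
    then have "antichain B"
      unfolding antichain_def using B(1) by blast
    then show ?thesis unfolding B(2) using anti small by blast
  qed
  ultimately show ?thesis unfolding Souslin_tree_def by blast
qed

end

subsection \<open>Translation from relations\<close>

text \<open>The choice in \<open>cf\<close> is well-defined because cofinal sets exist and cardinals
  are well-ordered.\<close>

lemma cf_witness:
  assumes "Well_order k" "cf k a <o l"
  shows "\<exists>A. cofinal_in k a A \<and> |A| <o l"
proof -
  have "cofinal_in k a (underS k a)"
    using assms(1) unfolding cofinal_in_def order_on_defs refl_on_def underS_def Field_def by blast
  then have "\<exists>r\<in>{|A| | A. cofinal_in k a A}. \<forall>r'\<in>{|A| | A. cofinal_in k a A}. r \<le>o r'"
    by (intro exists_minim_Card_order) (auto intro: card_of_Card_order)
  then have "\<exists>A. cofinal_in k a A \<and> (\<forall>B. cofinal_in k a B \<longrightarrow> |A| \<le>o |B| )"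
    by blast
  from someI_ex[OF this] show ?thesis
    using assms(2) unfolding cf_def by blast
qed

locale succ_card_rel = succ_card less_eq less K l
  for less_eq :: "'b \<Rightarrow> 'b \<Rightarrow> bool" (infix "\<preceq>" 50) and less :: "'b \<Rightarrow> 'b \<Rightarrow> bool" (infix "\<prec>" 50)
    and K :: "'b set" and l :: "'a rel" +
  fixes k :: "'b rel"
  assumes k_le: "(x, y) \<in> k \<longleftrightarrow> x \<in> K \<and> y \<in> K \<and> x \<preceq> y"
    and Well_order_k: "Well_order k"
begin

lemma Field_k: "Field k = K"
  using k_le unfolding Field_def by auto

lemma underS_k: "a \<in> K \<Longrightarrow> underS k a = below a"
  unfolding underS_def using k_le down le_less by auto

text \<open>All notions stated with suprema reduce to \<open>lp\<close> through this. As
  \<open>a\<close> is an upper bound, the supremum differs from \<open>a\<close> only if some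
  \<open>x \<prec> a\<close> already bounds \<open>C\<close> below \<open>a\<close>.\<close>

lemma sup_below_iff:
  assumes a: "a \<in> K"
  shows "sup_below k C a = a \<and> underS k a \<noteq> {} \<longleftrightarrow> lp C a"
proof -
  have wo: "wo_rel k" using Well_order_k by (simp add: wo_rel_def)
  let ?U = "Above k (C \<inter> underS k a)"
  have aU: "a \<in> ?U" using a Field_k unfolding Above_def underS_def by auto
  then have U: "?U \<subseteq> Field k" "?U \<noteq> {}" unfolding Above_def by auto
  have m: "sup_below k C a = wo_rel.minim k ?U"
    unfolding sup_below_def wo_rel.supr_def[OF wo] ..
  have mU: "sup_below k C a \<in> ?U" unfolding m using wo_rel.minim_in[OF wo U] .
  have least: "sup_below k C a \<preceq> b" if "b \<in> ?U" for b
    using wo_rel.minim_least[OF wo U(1) that] k_le unfolding m by blast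
  have U_iff: "b \<in> ?U \<longleftrightarrow> b \<in> K \<and> (\<forall>y\<in>C. y \<prec> a \<longrightarrow> y \<preceq> b)" for b
    unfolding Above_def Field_k underS_k[OF a] using k_le down[OF a] by auto
  have "sup_below k C a = a \<longleftrightarrow> (\<forall>x. x \<prec> a \<longrightarrow> (\<exists>y\<in>C. x \<prec> y \<and> y \<prec> a))"
  proof
    assume eq: "sup_below k C a = a"
    show "\<forall>x. x \<prec> a \<longrightarrow> (\<exists>y\<in>C. x \<prec> y \<and> y \<prec> a)"
    proof (intro allI impI)
      fix x assume x: "x \<prec> a"
      then have "x \<notin> ?U" using least[of x] leD unfolding eq by blast
      then show "\<exists>y\<in>C. x \<prec> y \<and> y \<prec> a"
        using down[OF a x] unfolding U_iff by (meson not_le)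
    qed
  next
    assume lim: "\<forall>x. x \<prec> a \<longrightarrow> (\<exists>y\<in>C. x \<prec> y \<and> y \<prec> a)"
    have "\<not> sup_below k C a \<prec> a"
    proof
      assume "sup_below k C a \<prec> a"
      then obtain y where "y \<in> C" "sup_below k C a \<prec> y" "y \<prec> a" using lim by blast
      then show False using mU leD unfolding U_iff by blast
    qed
    then show "sup_below k C a = a" using least[OF aU] by order
  qed
  then show ?thesis
    unfolding lp_def underS_k[OF a] below_def by blast
qed

lemma limit_ord_iff: "limit_ord k a \<longleftrightarrow> limit a"
  unfolding limit_ord_def limit_def Field_k using sup_below_iff[of a K] by blast

lemma acc_pts_iff: "C \<subseteq> K \<Longrightarrow> a \<in> acc_pts k C \<longleftrightarrow> a \<in> C \<and> lp C a"
  unfolding acc_pts_def using sup_below_iff[of a C] by blast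

lemma club_in_iff:
  assumes "U \<subseteq> K"
  shows "club_in k U C \<longleftrightarrow> C \<subseteq> U \<and> (\<forall>b\<in>U. \<exists>c\<in>C. b \<preceq> c) \<and> (\<forall>b\<in>U. lp C b \<longrightarrow> b \<in> C)"
proof -
  have "(\<exists>c\<in>C. (b, c) \<in> k) \<longleftrightarrow> (\<exists>c\<in>C. b \<preceq> c)" if "C \<subseteq> U" "b \<in> U" for b
    using that assms k_le by blast
  moreover have "sup_below k C b = b \<and> underS k b \<noteq> {} \<longleftrightarrow> lp C b" if "b \<in> U" for b
    using sup_below_iff that assms by blast
  ultimately show ?thesis
    unfolding club_in_def by blast
qed

lemma club_iff: "club_in k (Field k) D \<longleftrightarrow> club D"
  unfolding Field_k club_in_iff[OF subset_refl] club_def ..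

lemma stationary_iff: "stationary_in k S \<longleftrightarrow> stationary S"
  unfolding stationary_in_def stationary_def club_iff unfolding Field_k by blast

text \<open>Zero and successors have small cofinality and may lie in the given set, but the square
  sequence controls only limits. Intersecting with the club of limits keeps the set
  stationary.\<close>

lemma square_card:
  fixes \<C> :: "'b \<Rightarrow> 'b set set"
  assumes sq: "square_seq k l \<C>"
    and stat: "stationary_in k {\<alpha> \<in> E_less k l. |\<C> \<alpha>| <o l}"
  shows "square_card less_eq less K l \<C> ({\<alpha> \<in> E_less k l. |\<C> \<alpha>| <o l} \<inter> {a. limit a})"
    (is "square_card _ _ _ _ _ ?S")
proof -
  have sq_lim: "\<C> a \<noteq> {}" "|\<C> a| <o cardSuc l" "C \<in> \<C> a \<Longrightarrow> club_in k (underS k a) C"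
    "C \<in> \<C> a \<Longrightarrow> b \<in> acc_pts k C \<Longrightarrow> C \<inter> underS k b \<in> \<C> b"
    if "limit a" for a b C
    using sq that unfolding square_seq_def square_less_seq_def limit_ord_iff by blast+
  have club: "C \<subseteq> below a" "\<forall>b\<in>below a. \<exists>c\<in>C. b \<preceq> c" "\<forall>b\<in>below a. lp C b \<longrightarrow> b \<in> C" "C \<subseteq> K"
    if "limit a" "C \<in> \<C> a" for a C
  proof -
    have aK: "a \<in> K" using limitD(1)[OF that(1)] .
    show "C \<subseteq> below a" "\<forall>b\<in>below a. \<exists>c\<in>C. b \<preceq> c" "\<forall>b\<in>below a. lp C b \<longrightarrow> b \<in> C"
      using sq_lim(3)[OF that] unfolding underS_k[OF aK] club_in_iff[OF below_sub_K[OF aK]] by blast+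
    then show "C \<subseteq> K" using below_sub_K[OF aK] by blast
  qed
  show ?thesis
  proof unfold_locales
    fix a C b assume lim: "limit a" and C: "C \<in> \<C> a"
    show "C \<subseteq> below a" by (rule club(1)[OF lim C])
    show "\<exists>c\<in>C. b \<preceq> c" if "b \<prec> a" using club(2)[OF lim C] that by simp
    show "b \<in> C" if "b \<prec> a" "lp C b" using club(3)[OF lim C] that by simp
    show "C \<inter> below b \<in> \<C> b" if "b \<in> C" "lp C b"
      using sq_lim(4)[OF lim C, of b] that acc_pts_iff[OF club(4)[OF lim C]] underS_k[of b] club(4)[OF lim C] by auto
  next
    fix a assume lim: "limit a"
    show "\<C> a \<noteq> {}" by (rule sq_lim(1)[OF lim])
    show "|\<C> a| \<le>o l"
      using sq_lim(2)[OF lim] cardSuc_ordLeq_ordLess[OF card_l card_of_Card_order] by blast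
  next
    fix D assume D: "club D"
    then have DK: "D \<subseteq> K" by (rule clubD(1))
    obtain a where "a \<in> acc_pts k D" "D \<inter> underS k a \<notin> \<C> a"
      using sq D unfolding square_seq_def square_less_seq_def club_iff by blast
    then show "\<exists>a\<in>D. lp D a \<and> D \<inter> below a \<notin> \<C> a"
      using acc_pts_iff[OF DK] underS_k DK by (metis subsetD)
  next
    show "stationary ?S"
      using stat unfolding stationary_iff by (rule club_stationary_Int[OF _ club_limit])
  next
    fix a assume a: "a \<in> ?S"
    then show "limit a" by blast
    then have aK: "a \<in> K" by (rule limitD(1))
    show "|\<C> a| <o l" using a by blast
    have "cf k a <o l" using a unfolding E_less_def by blast
    then obtain A where A: "cofinal_in k a A" "|A| <o l"
      using cf_witness[OF Well_order_k] by blast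
    then show "\<exists>A. |A| <o l \<and> A \<subseteq> below a \<and> (\<forall>b. b \<prec> a \<longrightarrow> (\<exists>c\<in>A. b \<preceq> c))"
      unfolding cofinal_in_def underS_k[OF aK] using k_le by (intro exI[of _ A]) auto
  qed
qed

lemma ex_Souslin_tree_of_square:
  fixes \<C> :: "'b \<Rightarrow> 'b set set"
  assumes k: "Card_order k" "l <o k" and pow: "ctwo ^c l =o k"
    and sq: "square_seq k l \<C>"
    and stat: "stationary_in k {\<alpha> \<in> E_less k l. |\<C> \<alpha>| <o l}"
  shows "\<exists>R :: 'b rel. Souslin_tree k R"
proof -
  interpret square_card less_eq less K l \<C> "{\<alpha> \<in> E_less k l. |\<C> \<alpha>| <o l} \<inter> {a. limit a}"
    using sq stat by (rule square_card)
  have Kpow: "|K| =o ctwo ^c l"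
    using card_of_Field_ordIso[OF k(1)] pow ordIso_symmetric ordIso_transitive unfolding Field_k by blast
  have N: "all_nodes \<noteq> {}" using K_nonempty unfolding all_nodes_def by blast
  note card_N = card_all_nodes[OF Kpow]
  obtain f :: "'b \<Rightarrow> 'a \<Rightarrow> ('b \<times> 'b set) set" where f: "\<And>g. (\<And>i. i \<in> Field l \<Longrightarrow> g i \<noteq> {} \<and> g i \<subseteq> all_nodes \<and> |g i| \<le>o l) \<Longrightarrow>
      \<exists>b\<in>K. \<forall>i\<in>Field l. f b i = g i"
    using ex_enumeration[OF Kpow N card_N] by metis
  let ?V = "{Z. Z \<noteq> {} \<and> Z \<subseteq> all_nodes \<and> |Z| \<le>o l}"
  have "\<exists>b\<in>K. \<forall>i\<in>Field l. f b i = g i" if "\<And>i. i \<in> Field l \<Longrightarrow> g i \<in> ?V" for g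
    using f[of g] that by blast
  \<comment> \<open>The guesses are fixed here, before the levels \<open>T\<close>, which are then
    built from them.\<close>
  from guessing[OF this] obtain \<Psi> where \<Psi>: "\<forall>F D. (\<forall>x\<in>K. F x \<in> ?V) \<longrightarrow> club D \<longrightarrow>
      (\<exists>a\<in>{\<alpha> \<in> E_less k l. |\<C> \<alpha>| <o l} \<inter> {a. limit a}. \<forall>C\<in>\<C> a. \<forall>e. e \<prec> a \<longrightarrow>
        (\<exists>u v. consecutive C u v \<and> e \<prec> u \<and> (\<exists>m\<in>D. u \<prec> m \<and> m \<preceq> v) \<and> \<Psi> u v = F u))"
    by (rule exE)
  obtain T where "\<And>a. T a = next_level \<Psi> T a"
    using ex_levels by blast
  then interpret tree_levels less_eq less K l \<C> "{\<alpha> \<in> E_less k l. |\<C> \<alpha>| <o l} \<inter> {a. limit a}" \<Psi> T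
    by unfold_locales
  have "|nodes| \<le>o |K|"
  proof (rule ordLeq_transitive[OF card_of_mono1 card_N])
    show "nodes \<subseteq> all_nodes" using T_below unfolding nodes_def all_nodes_def by blast
  qed
  moreover have "|A| \<le>o l" if "antichain A" for A
    by (rule antichain_small[OF _ that], rule \<Psi>[rule_format]) auto
  ultimately show ?thesis
    using ex_Souslin_tree[OF k Field_k k_le] by blast
qed

end

lemma succ_card_rel_cardSuc:
  fixes l :: "'a rel"
  assumes l: "Card_order l" and unc: "natLeq <o l" and exp: "cexp_less l =o l"
    and r: "well_order_on UNIV r" "cardSuc l \<subseteq> r"
      "\<And>x y. (x, y) \<in> r \<Longrightarrow> y \<in> Field (cardSuc l) \<Longrightarrow> (x, y) \<in> cardSuc l"
  shows "succ_card_rel (\<lambda>x y. (x, y) \<in> r) (\<lambda>x y. (x, y) \<in> r \<and> x \<noteq> y) (Field (cardSuc l)) l (cardSuc l)"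
proof -
  let ?k = "cardSuc l"
  interpret wellorder "\<lambda>x y. (x, y) \<in> r" "\<lambda>x y. (x, y) \<in> r \<and> x \<noteq> y"
    using r(1) by (rule wellorder_of_well_order_on)
  have inf: "Cinfinite l"
    using l unc natLeq_cinfinite cinfinite_mono ordLess_imp_ordLeq by blast
  have k: "Card_order ?k" using l by (rule cardSuc_Card_order)
  have reg: "regularCard ?k" using inf by (rule regularCard_cardSuc)
  have infk: "infinite (Field ?k)" using Cinfinite_cardSuc[OF inf] unfolding cinfinite_def by blast
  have le_k: "|A| \<le>o l \<longleftrightarrow> |A| <o ?k" for A :: "'a set set"
    using cardSuc_ordLeq_ordLess[OF l card_of_Card_order] by blast
  show ?thesis
  proof unfold_locales
    fix x y assume "y \<in> Field ?k" "(x, y) \<in> r \<and> x \<noteq> y"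
    then show "x \<in> Field ?k" using r(3) unfolding Field_def by blast
  next
    fix a assume a: "a \<in> Field ?k"
    have "{x. (x, a) \<in> r \<and> x \<noteq> a} = underS ?k a"
      using r(2) r(3)[OF _ a] unfolding underS_def by blast
    then show "|{x. (x, a) \<in> r \<and> x \<noteq> a}| \<le>o l"
      using card_of_underS[OF k a] le_k by simp
  next
    fix A assume A: "A \<subseteq> Field ?k" "|A| \<le>o l"
    then have "\<not> |A| =o ?k" using le_k not_ordLess_ordIso by blast
    then have "\<not> cofinal A ?k" using reg A(1) unfolding regularCard_def by blast
    then obtain a where a: "a \<in> Field ?k" "\<And>b. b \<in> A \<Longrightarrow> a = b \<or> (a, b) \<notin> ?k"
      unfolding cofinal_def by blast
    \<comment> \<open>The bound \<open>a\<close> may be attained in \<open>A\<close>; a larger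
      \<open>b\<close> makes it strict.\<close>
    obtain b where b: "b \<in> Field ?k" "a \<noteq> b" "(a, b) \<in> ?k"
      using infinite_Card_order_limit[OF k infk a(1)] by blast
    have "(x, b) \<in> r \<and> x \<noteq> b" if "x \<in> A" for x
    proof -
      have "a = x \<or> (a, x) \<notin> r" using a(2)[OF that] r(3) A(1) that by blast
      moreover have "(a, b) \<in> r \<and> a \<noteq> b" using b r(2) by blast
      ultimately show ?thesis using linear le_less_trans order_refl by metis
    qed
    then show "\<exists>b\<in>Field ?k. \<forall>x\<in>A. (x, b) \<in> r \<and> x \<noteq> b" using b(1) by blast
  next
    show "Card_order l" "natLeq <o l" by fact+
  next
    fix P p assume "P \<subseteq> Field l" "|P| <o l" "p ` Field l \<subseteq> P"
    then show "\<exists>y. \<not> |{i\<in>Field l. p i = y}| <o l"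
      using pigeonhole_cexp_less[OF l exp] by blast
  next
    fix x y show "(x, y) \<in> ?k \<longleftrightarrow> x \<in> Field ?k \<and> y \<in> Field ?k \<and> (x, y) \<in> r"
      using r(2,3) unfolding Field_def by blast
  next
    show "Well_order ?k" using k by (rule card_order_on_well_order_on)
  qed
qed

theorem mainTheorem1:
  fixes l :: "'a rel"
    and \<C> :: "'a set \<Rightarrow> 'a set set set"
  assumes "Card_order l"
    and "natLeq <o l"
    and "cexp_less l =o l"
    and "ctwo ^c l =o cardSuc l"
    and "square_seq (cardSuc l) l \<C>"
    and "stationary_in (cardSuc l) {\<alpha> \<in> E_less (cardSuc l) l. |\<C> \<alpha>| <o l}"
  shows "\<exists>T :: 'a set rel. Souslin_tree (cardSuc l) T"
proof -
  have k: "Card_order (cardSuc l)" "l <o cardSuc l"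
    using assms(1) by (rule cardSuc_Card_order, rule cardSuc_greater)
  obtain r where "well_order_on UNIV r" "cardSuc l \<subseteq> r"
    "\<And>x y. (x, y) \<in> r \<Longrightarrow> y \<in> Field (cardSuc l) \<Longrightarrow> (x, y) \<in> cardSuc l"
    using well_order_on_UNIV_extend[OF card_order_on_well_order_on[OF k(1)]] by blast
  then interpret succ_card_rel "\<lambda>x y. (x, y) \<in> r" "\<lambda>x y. (x, y) \<in> r \<and> x \<noteq> y" "Field (cardSuc l)" l "cardSuc l"
    by (rule succ_card_rel_cardSuc[OF assms(1-3)])
  show ?thesis
    using k assms(4-6) by (rule ex_Souslin_tree_of_square)
qed

end
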